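(* Let $X$ and $Y$ be complex Banach spaces and let $\mathcal A,\mathcal B\in CLR(X,Y)$ be closed linear relations such that $\mathcal A$ has closed range $R(\mathcal A)$, $D(\mathcal B)\supset D(\mathcal A)$, $\mathcal B(0)\subset\mathcal A(0)$, and $$\Vert \mathcal B(x)\Vert\le \sigma\Vert x\Vert+\tau\Vert\mathcal A(x)\Vert\quad\text{for every } x\in D(\mathcal A),$$ where $\sigma$ and $\tau$ are non-negative constants. If $\nu(\mathcal A:\mathcal B)=\infty$, then $\alpha(\mathcal A-\lambda\mathcal B)$ and $\beta(\mathcal A-\lambda\mathcal B)$ are constant (independent of $\lambda$) for all $\lambda\in\mathbb C$ with $$|\lambda|<\frac{\gamma(\mathcal A)}{3\sigma+\tau\gamma(\mathcal A)}.$$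
   Context: A linear relation $\mathcal A$ from $X$ to $Y$ assigns to each $x$ in a linear subspace $D(\mathcal A)\subset X$ a nonempty set $\mathcal A(x)\subset Y$ such that the graph $G(\mathcal A)=\{(x,y): x\in D(\mathcal A),\ y\in\mathcal A(x)\}$ is a linear subspace of $X\times Y$. It is closed if $G(\mathcal A)$ is closed in $X\times Y$; $CLR(X,Y)$ is the set of closed linear relations from $X$ to $Y$. For $M\subset X$, $\mathcal A(M)=\bigcup_{x\in M\cap D(\mathcal A)}\mathcal A(x)$; $R(\mathcal A)=\mathcal A(X)$; for $N\subset Y$, $\mathcal A^{-1}(N)=\{x\in D(\mathcal A):\mathcal A(x)\cap N\neq\emptyset\}$; $N(\mathcal A)=\mathcal A^{-1}(0)$. The relation $\mathcal A-\lambda\mathcal B$ has domain $D(\mathcal A)\cap D(\mathcal B)$ and $(\mathcal A-\lambda\mathcal B)(x)=\{a-\lambda b: a\in\mathcal A(x), b\in\mathcal B(x)\}$. Norms: $Q_{\mathcal A}:Y\to Y/\overline{\mathcal A(0)}$ is the quotient map; $Q_{\mathcal A}\mathcal A$ is single valued, and $\Vert\mathcal A(x)\Vert:=\Vert Q_{\mathcal A}\mathcal A(x)\Vert$ (equal to $\mathrm{dist}(y,\mathcal A(0))$ for any $y\in\mathcal A(x)$). Likewise $\Vert\mathcal B(x)\Vert:=\Vert Q_{\mathcal B}\mathcal B(x)\Vert$. Lower bound: $\gamma(\mathcal A)=\sup\{\gamma\ge 0:\Vert\mathcal A(x)\Vert\ge\gamma\,\mathrm{dist}(x,N(\mathcal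 A))\ \forall x\in D(\mathcal A)\}\in[0,\infty]$; $\gamma(\mathcal A)=\infty$ iff $\mathcal A(x)=\mathcal A(0)$ for all $x\in D(\mathcal A)$. Nullity and deficiency: $\alpha(\mathcal A)=\dim N(\mathcal A)$, $\beta(\mathcal A)=\dim Y/R(\mathcal A)$ (possibly $\infty$). The quantity $\nu(\mathcal A:\mathcal B)$ (for $\mathcal B(0)\subset\mathcal A(0)$): put $M_0=X$, $M_n=\mathcal B^{-1}(\mathcal A(M_{n-1}))$ for $n\ge1$. Then $\nu(\mathcal A:\mathcal B)$ is the smallest positive integer $n$ for which $N(\mathcal A)\subset M_n$ fails, and $\nu(\mathcal A:\mathcal B)=\infty$ if there is no such $n$. Convention: if $\gamma(\mathcal A)=\infty$, the bound on $|\lambda|$ is read as $1/\tau$; a bound with zero denominator (such as $1/\tau$ with $\tau=0$) is read as $+\infty$. *)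

theory Defs
  imports "HOL-Analysis.Analysis"
begin

section \<open>Complex normed spaces\<close>

text \<open>The libraries provide normed spaces over the reals only.  The following classes extend them
  by a complex scalar multiplication that is compatible with the real one.\<close>

class complex_vector = real_vector +
  fixes scaleC :: "complex \<Rightarrow> 'a \<Rightarrow> 'a" (infixr \<open>*\<^sub>C\<close> 75)
  assumes scaleC_add_right: "a *\<^sub>C (x + y) = a *\<^sub>C x + a *\<^sub>C y"
    and scaleC_add_left: "(a + b) *\<^sub>C x = a *\<^sub>C x + b *\<^sub>C x"
    and scaleC_scaleC: "a *\<^sub>C b *\<^sub>C x = (a * b) *\<^sub>C x"
    and scaleC_of_real: "complex_of_real r *\<^sub>C x = r *\<^sub>R x"

class complex_normed_vector = complex_vector + real_normed_vector +
  assumes norm_scaleC: "norm (a *\<^sub>C x) = cmod a * norm x"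

class complex_banach = complex_normed_vector + complete_space

global_interpretation complex_vector: vector_space "scaleC :: complex \<Rightarrow> 'a \<Rightarrow> 'a::complex_vector"
  by unfold_locales
    (simp_all add: scaleC_add_right scaleC_add_left scaleC_scaleC
      scaleC_of_real[of 1, simplified])

instantiation complex :: complex_banach
begin

definition scaleC_complex_def: "scaleC a (z::complex) = a * z"

instance
  by standard (simp_all add: scaleC_complex_def algebra_simps norm_mult scaleR_conv_of_real)

end

instantiation prod :: (complex_vector, complex_vector) complex_vector
begin

definition scaleC_prod_def: "a *\<^sub>C z = (a *\<^sub>C fst z, a *\<^sub>C snd z)"

instance
  by standard (auto simp: scaleC_prod_def prod_eq_iff scaleC_add_right scaleC_add_left
      scaleC_scaleC scaleC_of_real)

end

instance prod :: (complex_normed_vector, complex_normed_vector) complex_normed_vector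
proof
  fix a :: complex and z :: "'a \<times> 'b"
  have "(cmod a * norm (fst z))\<^sup>2 + (cmod a * norm (snd z))\<^sup>2
      = (cmod a)\<^sup>2 * ((norm (fst z))\<^sup>2 + (norm (snd z))\<^sup>2)"
    by (simp add: algebra_simps power_mult_distrib)
  then show "norm (a *\<^sub>C z) = cmod a * norm z"
    by (simp add: scaleC_prod_def norm_prod_def norm_scaleC real_sqrt_mult)
qed

instance prod :: (complex_banach, complex_banach) complex_banach ..


section \<open>Quotients\<close>

text \<open>The elements of the quotient \<open>Y/M\<close> are represented as the cosets \<open>y + M\<close>, so that
  \<open>quot M\<close> is the quotient map.\<close>

definition quot :: "'b::ab_group_add set \<Rightarrow> 'b \<Rightarrow> 'b set" where
  "quot M y = (\<lambda>m. y + m) ` M"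

definition quot_norm :: "'b::real_normed_vector set \<Rightarrow> real" where
  "quot_norm C = (INF y\<in>C. norm y)"

text \<open>\<open>quot_basis M B\<close>: the cosets of the elements of the finite set \<open>B\<close> form a basis of \<open>Y/M\<close>
  (and are pairwise different).  A linear combination of the cosets of the elements of \<open>B\<close> is the
  coset of the linear combination, and \<open>quot M 0\<close> is the zero of \<open>Y/M\<close>.\<close>

definition quot_basis :: "'b::complex_vector set \<Rightarrow> 'b set \<Rightarrow> bool" where
  "quot_basis M B \<longleftrightarrow> finite B \<and>
     (\<forall>c. quot M (\<Sum>b\<in>B. c b *\<^sub>C b) = quot M 0 \<longrightarrow> (\<forall>b\<in>B. c b = 0)) \<and>
     (\<forall>y. \<exists>c. quot M y = quot M (\<Sum>b\<in>B. c b *\<^sub>C b))"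

definition quot_dim :: "'b::complex_vector set \<Rightarrow> enat" where
  "quot_dim M = (if \<exists>B. quot_basis M B then enat (card (SOME B. quot_basis M B)) else \<infinity>)"

text \<open>The library's \<open>dim\<close> is \<open>0\<close> for infinite-dimensional spaces.\<close>

definition cdim :: "'a::complex_vector set \<Rightarrow> enat" where
  "cdim S = (if \<exists>B. finite B \<and> S \<subseteq> complex_vector.span B
             then enat (complex_vector.dim S) else \<infinity>)"


section \<open>Linear relations\<close>

text \<open>A linear relation \<open>\<A>\<close> is identified with its graph.  Then
  \<open>D(\<A>)\<close> is \<open>Domain \<A>\<close>, \<open>R(\<A>)\<close> is \<open>Range \<A>\<close>, \<open>\<A>(x)\<close> is \<open>\<A> `` {x}\<close>,
  \<open>\<A>(M)\<close> is \<open>\<A> `` M\<close> and \<open>\<A>\<^sup>-\<^sup>1(N)\<close> is \<open>\<A>\<inverse> `` N\<close>.\<close>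

definition linear_relation :: "('a::complex_vector \<times> 'b::complex_vector) set \<Rightarrow> bool" where
  "linear_relation A \<longleftrightarrow> complex_vector.subspace A"

definition CLR :: "('a::complex_normed_vector \<times> 'b::complex_normed_vector) set set" where
  "CLR = {A. linear_relation A \<and> closed A}"

definition rel_kernel :: "('a \<times> 'b::zero) set \<Rightarrow> 'a set" where
  "rel_kernel A = A\<inverse> `` {0}"

definition rel_pencil ::
  "('a \<times> 'b::complex_vector) set \<Rightarrow> complex \<Rightarrow> ('a \<times> 'b) set \<Rightarrow> ('a \<times> 'b) set" where
  "rel_pencil A l B = {(x, a - l *\<^sub>C b) |x a b. (x, a) \<in> A \<and> (x, b) \<in> B}"

text \<open>The norm of the unique element of the image of \<open>\<A>(x)\<close> under the quotient map
  \<open>Y \<rightarrow> Y/closure(\<A>(0))\<close>; see \<open>rel_norm_eq_infdist\<close> below.\<close>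

definition rel_norm :: "('a::zero \<times> 'b::real_normed_vector) set \<Rightarrow> 'a \<Rightarrow> real" where
  "rel_norm A x = quot_norm (THE C. quot (closure (A `` {0})) ` (A `` {x}) = {C})"

definition lower_bound ::
  "('a::real_normed_vector \<times> 'b::real_normed_vector) set \<Rightarrow> ereal" where
  "lower_bound A = Sup {ereal g |g. 0 \<le> g \<and>
     (\<forall>x\<in>Domain A. rel_norm A x \<ge> g * infdist x (rel_kernel A))}"

definition nullity :: "('a::complex_vector \<times> 'b::complex_vector) set \<Rightarrow> enat" where
  "nullity A = cdim (rel_kernel A)"

definition deficiency :: "('a::complex_vector \<times> 'b::complex_vector) set \<Rightarrow> enat" where
  "deficiency A = quot_dim (Range A)"

primrec M_seq :: "('a \<times> 'b) set \<Rightarrow> ('a \<times> 'b) set \<Rightarrow> nat \<Rightarrow> 'a set" where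
  "M_seq A B 0 = UNIV"
| "M_seq A B (Suc n) = B\<inverse> `` (A `` M_seq A B n)"

definition nu :: "('a \<times> 'b::zero) set \<Rightarrow> ('a \<times> 'b) set \<Rightarrow> enat" where
  "nu A B = (if \<exists>n\<ge>1. \<not> rel_kernel A \<subseteq> M_seq A B n
             then enat (LEAST n. n \<ge> 1 \<and> \<not> rel_kernel A \<subseteq> M_seq A B n) else \<infinity>)"

text \<open>The bound \<open>g / (3 * s + t * g)\<close>, read as \<open>1 / t\<close> for \<open>g = \<infinity>\<close>, where a bound with
  denominator zero is \<open>\<infinity>\<close>.\<close>

definition pencil_bound :: "real \<Rightarrow> real \<Rightarrow> ereal \<Rightarrow> ereal" where
  "pencil_bound s t g =
     (if g = \<infinity> then (if t = 0 then \<infinity> else ereal (1 / t))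
      else if 3 * ereal s + ereal t * g = 0 then \<infinity>
      else g / (3 * ereal s + ereal t * g))"


lemma rel_norm_eq_infdist:
  fixes A :: "('a::complex_normed_vector \<times> 'b::complex_normed_vector) set"
  assumes A: "linear_relation A" and xy: "(x, y) \<in> A"
  shows "rel_norm A x = infdist y (A `` {0})"
proof -
  let ?Z = "A `` {0}" and ?M = "closure (A `` {0})"
  have sub: "complex_vector.subspace A"
    using A by (simp add: linear_relation_def)
  have zero: "0 \<in> ?Z"
    using complex_vector.subspace_0[OF sub] by (simp add: zero_prod_def)
  have diff: "v - w \<in> ?Z" if "(u, v) \<in> A" "(u, w) \<in> A" for u v w
    using complex_vector.subspace_diff[OF sub that] by simp
  have Z: "subspace ?Z"
  proof (rule subspaceI)
    show "v + w \<in> ?Z" if "v \<in> ?Z" "w \<in> ?Z" for v w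
      using complex_vector.subspace_add[OF sub, of "(0, v)" "(0, w)"] that by simp
    show "c *\<^sub>R v \<in> ?Z" if "v \<in> ?Z" for c v
      using complex_vector.subspace_scale[OF sub, of "(0, v)" "complex_of_real c"] that
      by (simp add: scaleC_of_real)
  qed (rule zero)
  have M: "subspace ?M"
  proof (rule subspaceI)
    show "0 \<in> ?M"
      using zero closure_subset by blast
  next
    fix v w assume "v \<in> ?M" "w \<in> ?M"
    then obtain f g where f: "\<And>n::nat. f n \<in> ?Z" "f \<longlonglongrightarrow> v"
      and g: "\<And>n::nat. g n \<in> ?Z" "g \<longlonglongrightarrow> w"
      unfolding closure_sequential by metis
    then have "(\<lambda>n. f n + g n) \<longlonglongrightarrow> v + w" "\<And>n. f n + g n \<in> ?Z"
      using subspace_add[OF Z] by (auto intro!: tendsto_add simp del: Image_singleton_iff)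
    then show "v + w \<in> ?M"
      unfolding closure_sequential by (intro exI[of _ "\<lambda>n. f n + g n"]) simp
  next
    fix c :: real and v assume "v \<in> ?M"
    then obtain f where f: "\<And>n::nat. f n \<in> ?Z" "f \<longlonglongrightarrow> v"
      unfolding closure_sequential by metis
    then have "(\<lambda>n. c *\<^sub>R f n) \<longlonglongrightarrow> c *\<^sub>R v" "\<And>n. c *\<^sub>R f n \<in> ?Z"
      using subspace_scale[OF Z] by (auto intro!: tendsto_intros simp del: Image_singleton_iff)
    then show "c *\<^sub>R v \<in> ?M"
      unfolding closure_sequential by (intro exI[of _ "\<lambda>n. c *\<^sub>R f n"]) simp
  qed
  have quot_eq: "quot ?M v = quot ?M y" if "(x, v) \<in> A" for v
  proof -
    have d: "v - y \<in> ?M"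
      using diff[OF that xy] closure_subset by blast
    have "\<exists>m'\<in>?M. v + m = y + m'" if "m \<in> ?M" for m
      using subspace_add[OF M d that] by (intro bexI[of _ "(v - y) + m"]) auto
    moreover have "\<exists>m'\<in>?M. y + m = v + m'" if "m \<in> ?M" for m
      using subspace_diff[OF M that d] by (intro bexI[of _ "m - (v - y)"]) auto
    ultimately show ?thesis
      unfolding quot_def image_def by blast
  qed
  have "quot ?M ` (A `` {x}) = {quot ?M y}"
  proof (intro equalityI subsetI)
    fix C assume "C \<in> quot ?M ` (A `` {x})"
    then obtain v where "(x, v) \<in> A" "C = quot ?M v"
      by blast
    then show "C \<in> {quot ?M y}"
      by (simp only: quot_eq singleton_iff)
  qed (use xy in blast)
  then have "rel_norm A x = quot_norm (quot ?M y)"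
    unfolding rel_norm_def by simp
  also have "\<dots> = (INF m\<in>?M. norm (y + m))"
    by (simp add: quot_norm_def quot_def image_image)
  also have "\<dots> = (INF m\<in>?M. dist y m)"
  proof -
    have "(\<lambda>m. norm (y + m)) ` ?M = (\<lambda>m. dist y m) ` uminus ` ?M"
      by (simp add: image_image dist_norm)
    also have "uminus ` ?M = ?M"
    proof (intro equalityI subsetI)
      fix z assume "z \<in> ?M"
      then show "z \<in> uminus ` ?M"
        using subspace_neg[OF M, of z] by (intro image_eqI[of _ _ "- z"]) simp_all
    qed (use subspace_neg[OF M] in blast)
    finally show ?thesis by simp
  qed
  also have "\<dots> = infdist y ?M"
  proof -
    have "?M \<noteq> {}"
      using zero closure_subset by blast
    then show ?thesis
      by (rule infdist_notempty[symmetric])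
  qed
  also have "\<dots> = infdist y ?Z"
    by (simp add: infdist_eq_setdist)
  finally show ?thesis .
qed

end

theory Submission
  imports Defs
begin

text \<open>
  Nullity and deficiency are determined by the natural numbers \<open>n\<close> that they dominate, and the
  property of having at least dimension \<open>n\<close> survives every perturbation whose relative size is
  below a number depending on \<open>n\<close> only (\<open>reldim_ge_perturb\<close>). So it suffices to show that, on a disc
  \<open>\<bar>\<lambda>\<bar> \<le> \<rho>\<close> with \<open>\<rho>\<close> below the bound, the kernel and the range of \<open>\<A> - \<lambda>\<B>\<close> depend on \<open>\<lambda>\<close> in a
  Lipschitz way. The property is then locally constant in \<open>\<lambda>\<close>, and constant because a disc is
  connected. Infinite dimensions need no separate treatment.

  \<^emph>\<open>Kernels.\<close> That \<open>\<nu>(\<A>:\<B>) = \<infinity>\<close> means that \<open>N(\<A>)\<close> lies in the intersection \<open>M\<close> of all \<open>M\<^sub>n\<close>. Then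
  \<open>\<B>(M) \<subseteq> \<A>(M)\<close> (\<open>M_inf_step\<close>), so that the perturbation never leaves the range of \<open>\<A>\<close> on \<open>M\<close>:
  for \<open>y \<in> \<A>(M)\<close> a Neumann series \<open>w = \<Sum>\<lambda>\<^sup>n w\<^sub>n\<close> with \<open>\<A> w\<^sub>0 \<ni> y\<close> and \<open>\<A> w\<^sub>n\<^sub>+\<^sub>1 \<inter> \<B> w\<^sub>n \<noteq> \<emptyset>\<close> solves
  \<open>(\<A> - \<lambda>\<B>)w \<ni> y\<close> (\<open>pencil_solvable\<close>). All kernels \<open>N(\<A> - \<mu>\<B>)\<close> lie in \<open>M\<close>. Given \<open>u\<close> in such a kernel
  and \<open>b \<in> \<B> u\<close>, a solution of \<open>(\<A> - \<lambda>\<B>)w \<ni> b\<close> yields the nearby element \<open>u - (\<mu> - \<lambda>)w\<close> of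
  \<open>N(\<A> - \<lambda>\<B>)\<close> (\<open>kernel_gap\<close>).

  \<^emph>\<open>Ranges.\<close> Every \<open>y\<close> in the range of \<open>\<A> - \<mu>\<B>\<close> has a preimage of norm at most a constant times
  \<open>\<parallel>y\<parallel>\<close>, uniformly in \<open>\<mu>\<close> (\<open>pencil_bounded_below\<close>). To see this, take any preimage \<open>x\<close>, an element
  of \<open>N(\<A>)\<close> close to \<open>x\<close>, and an element of \<open>N(\<A> - \<mu>\<B>)\<close> close to that one; subtracting the latter
  from \<open>x\<close> shrinks the norm by a factor \<open>\<theta>\<close>, up to a multiple of \<open>\<parallel>y\<parallel>\<close>. With \<open>s = \<rho>\<sigma>/\<gamma>(\<A>)\<close> and
  \<open>t = \<rho>\<tau>\<close> one gets \<open>\<theta> = 2s / (1 - s - t)\<close>, and \<open>\<theta> < 1\<close> says \<open>3s + t < 1\<close>: this is where the \<open>3\<close> in the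
  bound comes from. Bounded preimages make the ranges closed (\<open>closed_Range_pencil\<close>) and Lipschitz
  in \<open>\<mu>\<close> (\<open>range_gap\<close>).

  Closedness of \<open>R(\<A>)\<close> gives \<open>\<gamma>(\<A>) > 0\<close> by the open mapping theorem, which is proved here for
  closed linear relations (\<open>open_mapping_relation\<close>).
\<close>

section \<open>Dimension relative to a subspace\<close>

abbreviation cspan :: "'a::complex_vector set \<Rightarrow> 'a set" where
  "cspan \<equiv> complex_vector.span"

abbreviation csubspace :: "'a::complex_vector set \<Rightarrow> bool" where
  "csubspace \<equiv> complex_vector.subspace"

text \<open>For a subspace \<open>F \<subseteq> E\<close> this says \<open>dim E/F \<ge> n\<close>. The case \<open>F = {0}\<close> measures nullities and the
  case \<open>E = UNIV\<close> deficiencies. The recursion adjoins one vector at a time to \<open>F\<close>, which is the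
  form needed by the induction in the perturbation theorem below.\<close>
primrec reldim_ge :: "nat \<Rightarrow> 'a::complex_vector set \<Rightarrow> 'a set \<Rightarrow> bool" where
  "reldim_ge 0 E F \<longleftrightarrow> True"
| "reldim_ge (Suc n) E F \<longleftrightarrow> (\<exists>f\<in>E - F. reldim_ge n E (cspan (insert f F)))"

lemma reldim_ge_Suc_imp: "reldim_ge (Suc n) E F \<Longrightarrow> reldim_ge n E F"
proof (induction n arbitrary: F)
  case (Suc n)
  from Suc.prems obtain f where "f \<in> E - F" "reldim_ge (Suc n) E (cspan (insert f F))"
    by (auto simp only: reldim_ge.simps)
  with Suc.IH show ?case by auto
qed simp

lemma reldim_ge_mono: "reldim_ge n E F \<Longrightarrow> m \<le> n \<Longrightarrow> reldim_ge m E F"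
  by (induction n) (use reldim_ge_Suc_imp le_Suc_eq in blast)+

lemma cspan_subspace: "csubspace F \<Longrightarrow> cspan F = F"
  by simp

lemma in_cspan_insert_subspace:
  assumes "csubspace F"
  shows "x \<in> cspan (insert f F) \<longleftrightarrow> (\<exists>c. x - c *\<^sub>C f \<in> F)"
  using assms by (simp add: complex_vector.span_breakdown_eq cspan_subspace)

text \<open>The Steinitz exchange argument modulo \<open>F\<close>: the first new vector \<open>f\<close> replaces some \<open>b \<in> S\<close>, and
  \<open>S - {b}\<close> still generates \<open>E\<close> modulo the enlarged subspace.\<close>
lemma reldim_ge_le_card:
  assumes "reldim_ge n E F" "csubspace F" "finite S" "E \<subseteq> cspan (F \<union> S)"
  shows "n \<le> card S"
  using assms
proof (induction n arbitrary: F S)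
  case (Suc n)
  from Suc.prems obtain f where f: "f \<in> E" "f \<notin> F"
    and n: "reldim_ge n E (cspan (insert f F))"
    by auto
  have "finite T \<Longrightarrow> f \<in> cspan (F \<union> T) \<Longrightarrow>
      \<exists>b\<in>T. b \<in> cspan (insert f (F \<union> (T - {b})))" for T
  proof (induction T rule: finite_induct)
    case empty
    then show ?case using f Suc.prems(2) by (simp add: cspan_subspace)
  next
    case (insert b T)
    show ?case
    proof (cases "f \<in> cspan (F \<union> T)")
      case True
      then obtain b' where b': "b' \<in> T" "b' \<in> cspan (insert f (F \<union> (T - {b'})))"
        using insert.IH by blast
      have "cspan (insert f (F \<union> (T - {b'}))) \<subseteq> cspan (insert f (F \<union> (insert b T - {b'})))"
        by (rule complex_vector.span_mono) auto
      with b' show ?thesis by blast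
    next
      case False
      have "b \<in> cspan (insert f (F \<union> T))"
        by (rule complex_vector.in_span_insert) (use insert.prems False in auto)
      moreover have "insert b T - {b} = T" using insert.hyps by auto
      ultimately show ?thesis by auto
    qed
  qed
  from this[of S] Suc.prems f obtain b
    where b: "b \<in> S" "b \<in> cspan (insert f (F \<union> (S - {b})))"
    by blast
  have sub: "insert f (F \<union> (S - {b})) \<subseteq> cspan (insert f F) \<union> (S - {b})"
    using complex_vector.span_superset[of "insert f F"] by auto
  have "F \<union> S \<subseteq> cspan (cspan (insert f F) \<union> (S - {b}))"
    using b complex_vector.span_mono[OF sub] complex_vector.span_superset[of "insert f F"]
      complex_vector.span_superset[of "cspan (insert f F) \<union> (S - {b})"] by auto
  then have "cspan (F \<union> S) \<subseteq> cspan (cspan (insert f F) \<union> (S - {b}))"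
    by (rule complex_vector.span_minimal) simp
  with Suc.prems have "n \<le> card (S - {b})"
    by (intro Suc.IH[OF n]) auto
  with b Suc.prems show ?case
    by (metis Suc_le_mono card_Suc_Diff1)
qed simp

text \<open>Adjoining vectors of \<open>E\<close> outside the subspace reached so far has to stop after at most \<open>n\<close>
  steps; the adjoined vectors then generate.\<close>
lemma not_reldim_ge_imp_spanning:
  assumes "\<not> reldim_ge (Suc n) E F" "csubspace F"
  shows "\<exists>S. finite S \<and> card S \<le> n \<and> S \<subseteq> E \<and> E \<subseteq> cspan (F \<union> S)"
  using assms
proof (induction n arbitrary: F)
  case 0
  then show ?case
    using complex_vector.span_superset[of F] by (intro exI[of _ "{}"]) auto
next
  case (Suc n)
  show ?case
  proof (cases "E \<subseteq> F")
    case True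
    then show ?thesis
      using complex_vector.span_superset[of F] by (intro exI[of _ "{}"]) auto
  next
    case False
    then obtain f where f: "f \<in> E" "f \<notin> F" by auto
    with Suc.prems have "\<not> reldim_ge (Suc n) E (cspan (insert f F))"
      by (metis DiffI reldim_ge.simps(2))
    from Suc.IH[OF this] obtain S where S: "finite S" "card S \<le> n" "S \<subseteq> E"
      "E \<subseteq> cspan (cspan (insert f F) \<union> S)"
      by auto
    have "cspan (insert f F) \<subseteq> cspan (F \<union> insert f S)"
      by (rule complex_vector.span_mono) auto
    then have "cspan (insert f F) \<union> S \<subseteq> cspan (F \<union> insert f S)"
      using complex_vector.span_superset[of "F \<union> insert f S"] by auto
    then have "cspan (cspan (insert f F) \<union> S) \<subseteq> cspan (F \<union> insert f S)"
      by (rule complex_vector.span_minimal) simp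
    with S f show ?thesis
      by (intro exI[of _ "insert f S"]) (auto simp: card_insert_if)
  qed
qed

definition indep_mod :: "'a::complex_vector set \<Rightarrow> 'a set \<Rightarrow> bool" where
  "indep_mod F S \<longleftrightarrow> (\<forall>c. (\<Sum>b\<in>S. c b *\<^sub>C b) \<in> F \<longrightarrow> (\<forall>b\<in>S. c b = 0))"

lemma indep_mod_imp_reldim_ge:
  assumes "finite S" "S \<subseteq> E" "csubspace F" "indep_mod F S"
  shows "reldim_ge (card S) E F"
  using assms
proof (induction S arbitrary: F rule: finite_induct)
  case (insert b S)
  have "b \<notin> F"
  proof
    assume "b \<in> F"
    moreover have "(\<Sum>s\<in>insert b S. (if s = b then 1 else 0) *\<^sub>C s) = b"
      using insert.hyps by (simp add: sum.neutral if_distrib[of "\<lambda>c. c *\<^sub>C _"] cong: if_cong)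
    ultimately show False
      using insert.prems(3)[unfolded indep_mod_def, rule_format, of "\<lambda>s. if s = b then 1 else 0" b]
      by simp
  qed
  moreover have "indep_mod (cspan (insert b F)) S"
    unfolding indep_mod_def
  proof (intro allI impI ballI)
    fix c s
    assume "(\<Sum>b\<in>S. c b *\<^sub>C b) \<in> cspan (insert b F)" and s: "s \<in> S"
    then obtain k where k: "(\<Sum>b\<in>S. c b *\<^sub>C b) - k *\<^sub>C b \<in> F"
      using insert.prems by (auto simp: in_cspan_insert_subspace)
    let ?c = "c(b := - k)"
    have "(\<Sum>s\<in>insert b S. ?c s *\<^sub>C s) = (\<Sum>b\<in>S. c b *\<^sub>C b) - k *\<^sub>C b"
    proof -
      have "(\<Sum>s\<in>S. ?c s *\<^sub>C s) = (\<Sum>b\<in>S. c b *\<^sub>C b)"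
        using insert.hyps by (intro sum.cong) auto
      then show ?thesis
        using insert.hyps by simp
    qed
    with k insert.prems(3) have "\<forall>s\<in>insert b S. ?c s = 0"
      unfolding indep_mod_def by metis
    with s insert.hyps show "c s = 0" by (metis fun_upd_other insertCI)
  qed
  ultimately show ?case
    using insert by (auto intro!: bexI[of _ b])
qed simp

lemma spanning_minimal_imp_indep_mod:
  assumes F: "csubspace F" and S: "finite S" "E \<subseteq> cspan (F \<union> S)"
    and min: "\<And>T. finite T \<Longrightarrow> E \<subseteq> cspan (F \<union> T) \<Longrightarrow> card S \<le> card T"
  shows "indep_mod F S"
  unfolding indep_mod_def
proof (intro allI impI ballI, rule ccontr)
  fix c b
  assume sum: "(\<Sum>b\<in>S. c b *\<^sub>C b) \<in> F" and b: "b \<in> S" and nz: "c b \<noteq> 0"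
  let ?V = "cspan (F \<union> (S - {b}))"
  have "(\<Sum>b\<in>S. c b *\<^sub>C b) \<in> ?V"
    using sum by (intro complex_vector.span_base) simp
  moreover have "(\<Sum>s\<in>S - {b}. c s *\<^sub>C s) \<in> ?V"
    by (intro complex_vector.span_sum complex_vector.span_scale complex_vector.span_base) simp
  ultimately have "(\<Sum>b\<in>S. c b *\<^sub>C b) - (\<Sum>s\<in>S - {b}. c s *\<^sub>C s) \<in> ?V"
    by (rule complex_vector.span_diff)
  also have "(\<Sum>b\<in>S. c b *\<^sub>C b) - (\<Sum>s\<in>S - {b}. c s *\<^sub>C s) = c b *\<^sub>C b"
    using b S by (simp add: sum.remove)
  finally have "(1 / c b) *\<^sub>C c b *\<^sub>C b \<in> ?V"
    by (rule complex_vector.span_scale)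
  then have "b \<in> ?V"
    using nz by simp
  then have "F \<union> S \<subseteq> ?V"
    using complex_vector.span_superset[of "F \<union> (S - {b})"] by auto
  then have "cspan (F \<union> S) \<subseteq> ?V"
    by (rule complex_vector.span_minimal) simp
  with S min[of "S - {b}"] have "card S \<le> card (S - {b})" by auto
  with b S show False
    by (metis card_Diff1_less not_le)
qed

lemma le_cdim_iff_reldim_ge:
  assumes "csubspace E"
  shows "enat n \<le> cdim E \<longleftrightarrow> reldim_ge n E {0}"
proof (cases "\<exists>S. finite S \<and> E \<subseteq> cspan S")
  case True
  then obtain S where S: "finite S" "E \<subseteq> cspan S" by blast
  obtain C where C: "C \<subseteq> E" "complex_vector.independent C" "E \<subseteq> cspan C"
    "card C = complex_vector.dim E"
    using complex_vector.basis_exists by metis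
  have finC: "finite C"
    using complex_vector.independent_span_bound[OF S(1) C(2)] C(1) S(2) by blast
  have "indep_mod {0} C"
    using C(2) finC complex_vector.independentD[of C C] by (auto simp: indep_mod_def)
  then have "reldim_ge (card C) E {0}"
    by (intro indep_mod_imp_reldim_ge finC C(1)) simp_all
  moreover have "m \<le> card C" if "reldim_ge m E {0}" for m
    using reldim_ge_le_card[OF that _ finC] C(3) complex_vector.span_mono[of C "{0} \<union> C"] by auto
  ultimately have "reldim_ge n E {0} \<longleftrightarrow> n \<le> card C"
    using reldim_ge_mono by blast
  with True C show ?thesis by (simp add: cdim_def)
next
  case False
  have "reldim_ge (Suc n) E {0}"
  proof (rule ccontr)
    assume "\<not> reldim_ge (Suc n) E {0}"
    then obtain S where "finite S" "E \<subseteq> cspan ({0} \<union> S)"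
      using not_reldim_ge_imp_spanning[of n E "{0}"] by auto
    with False show False by auto
  qed
  then have "reldim_ge n E {0}" by (rule reldim_ge_Suc_imp)
  with False show ?thesis by (auto simp: cdim_def)
qed

lemma quot_eq_iff:
  assumes "csubspace F"
  shows "quot F x = quot F y \<longleftrightarrow> x - y \<in> F"
proof
  assume eq: "quot F x = quot F y"
  have "x + 0 \<in> quot F x"
    unfolding quot_def using complex_vector.subspace_0[OF assms] by blast
  with eq obtain m where "m \<in> F" "x = y + m" by (auto simp: quot_def)
  then show "x - y \<in> F" by simp
next
  have sub: "quot F u \<subseteq> quot F v" if "u - v \<in> F" for u v
  proof
    fix z assume "z \<in> quot F u"
    then obtain m where "m \<in> F" "z = u + m" by (auto simp: quot_def)
    then have "z = v + ((u - v) + m)" "(u - v) + m \<in> F"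
      using that complex_vector.subspace_add[OF assms] by auto
    then show "z \<in> quot F v" unfolding quot_def by blast
  qed
  assume "x - y \<in> F"
  moreover from this have "y - x \<in> F"
    using complex_vector.subspace_neg[OF assms, of "x - y"] by simp
  ultimately show "quot F x = quot F y" using sub by blast
qed

lemma quot_basis_iff:
  assumes "csubspace F"
  shows "quot_basis F S \<longleftrightarrow> finite S \<and> indep_mod F S \<and> UNIV \<subseteq> cspan (F \<union> S)"
proof -
  have "UNIV \<subseteq> cspan (F \<union> S) \<longleftrightarrow> (\<forall>y. \<exists>c. y - (\<Sum>b\<in>S. c b *\<^sub>C b) \<in> F)"
    if S: "finite S"
  proof -
    have "y \<in> cspan (F \<union> S) \<longleftrightarrow> (\<exists>c. y - (\<Sum>b\<in>S. c b *\<^sub>C b) \<in> F)"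
      for y
    proof -
      have "y \<in> cspan (F \<union> S) \<longleftrightarrow> (\<exists>f c. f \<in> F \<and> y = f + (\<Sum>b\<in>S. c b *\<^sub>C b))"
        using assms S
        by (auto simp: complex_vector.span_Un complex_vector.span_finite cspan_subspace)
      also have "\<dots> \<longleftrightarrow> (\<exists>c. y - (\<Sum>b\<in>S. c b *\<^sub>C b) \<in> F)"
        by (metis add_diff_cancel_right' diff_add_cancel)
      finally show ?thesis .
    qed
    then show ?thesis by (simp add: subset_eq)
  qed
  then show ?thesis
    unfolding quot_basis_def indep_mod_def quot_eq_iff[OF assms] by auto
qed

lemma le_quot_dim_iff_reldim_ge:
  assumes "csubspace F"
  shows "enat n \<le> quot_dim F \<longleftrightarrow> reldim_ge n UNIV F"
proof (cases "\<exists>S. quot_basis F S")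
  case True
  define S where "S = (SOME S. quot_basis F S)"
  have "quot_basis F S"
    unfolding S_def using True by (rule someI_ex)
  then have S: "finite S" "indep_mod F S" "UNIV \<subseteq> cspan (F \<union> S)"
    using assms by (auto simp: quot_basis_iff)
  have "reldim_ge (card S) UNIV F"
    using S assms by (intro indep_mod_imp_reldim_ge) auto
  then have "reldim_ge n UNIV F \<longleftrightarrow> n \<le> card S"
    using reldim_ge_mono reldim_ge_le_card[OF _ assms S(1,3)] by blast
  with True show ?thesis by (simp add: quot_dim_def S_def)
next
  case False
  have "reldim_ge (Suc n) UNIV F"
  proof (rule ccontr)
    let ?P = "\<lambda>S. finite S \<and> UNIV \<subseteq> cspan (F \<union> S)"
    assume "\<not> reldim_ge (Suc n) UNIV F"
    then have "\<exists>S. ?P S"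
      using not_reldim_ge_imp_spanning[OF _ assms, of n UNIV] by blast
    then obtain S where S: "?P S" "\<And>T. ?P T \<Longrightarrow> card S \<le> card T"
      using ex_has_least_nat[of ?P _ card] by metis
    then have "indep_mod F S"
      by (intro spanning_minimal_imp_indep_mod[OF assms, of S UNIV]) auto
    with S False assms show False by (auto simp: quot_basis_iff)
  qed
  then have "reldim_ge n UNIV F" by (rule reldim_ge_Suc_imp)
  with False show ?thesis by (simp add: quot_dim_def)
qed

section \<open>Stability of relative dimension under small perturbations\<close>

text \<open>This makes the limit and summation rules for bounded bilinear maps available for the complex
  scalar multiplication.\<close>
lemma bounded_bilinear_scaleC:
  "bounded_bilinear (scaleC :: complex \<Rightarrow> 'a::complex_normed_vector \<Rightarrow> 'a)"
proof
  fix r :: real and a :: complex and x :: 'a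
  show "(r *\<^sub>R a) *\<^sub>C x = r *\<^sub>R (a *\<^sub>C x)"
    by (simp add: scaleR_conv_of_real flip: scaleC_of_real)
  show "a *\<^sub>C (r *\<^sub>R x) = r *\<^sub>R (a *\<^sub>C x)"
    by (simp add: mult.commute flip: scaleC_of_real)
  show "\<exists>K. \<forall>a (x::'a). norm (a *\<^sub>C x) \<le> norm a * norm x * K"
    by (intro exI[of _ 1]) (simp add: norm_scaleC)
qed (simp_all add: scaleC_add_left scaleC_add_right)

lemma infdist_near_point:
  assumes "F \<noteq> {}" "infdist x F < e"
  shows "\<exists>r\<in>F. dist x r < e"
  using assms by (auto simp: infdist_notempty cINF_less_iff bdd_below_image_dist)

text \<open>Riesz's lemma: moving \<open>f\<close> by an element of \<open>F\<close> and rescaling does not change the span with \<open>F\<close>,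
  but makes \<open>f\<close> a vector of controlled norm that is almost orthogonal to \<open>F\<close>.\<close>
lemma Riesz_reldim:
  fixes F :: "'a::complex_normed_vector set"
  assumes F: "closed F" "csubspace F" and E: "csubspace E" "F \<subseteq> E" and f: "f \<in> E - F"
  shows "\<exists>g\<in>E - F. norm g \<le> 2 \<and> (\<forall>r\<in>F. 1 \<le> norm (g - r)) \<and> cspan (insert g F) = cspan (insert f F)"
proof -
  define d where "d = infdist f F"
  have ne: "F \<noteq> {}" using complex_vector.subspace_0[OF F(2)] by auto
  have d: "d > 0" unfolding d_def
    using f F ne by (intro infdist_pos_not_in_closed) auto
  then obtain r where r: "r \<in> F" "dist f r < 2 * d"
    using infdist_near_point[OF ne, of f "2 * d"] by (auto simp: d_def)
  define g where "g = complex_of_real (1 / d) *\<^sub>C (f - r)"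
  have f_eq: "f = complex_of_real d *\<^sub>C g + r"
    using d by (simp add: g_def flip: of_real_mult)
  have "g \<in> E"
    unfolding g_def using f r E by (intro complex_vector.subspace_scale complex_vector.subspace_diff) auto
  moreover have "g \<notin> F"
  proof
    assume "g \<in> F"
    then have "complex_of_real d *\<^sub>C g + r \<in> F"
      using r F by (intro complex_vector.subspace_add complex_vector.subspace_scale)
    with f f_eq show False by simp
  qed
  moreover have "norm g \<le> 2"
  proof -
    have "norm g = norm (f - r) / d"
      using d by (simp only: g_def norm_scaleC norm_of_real) simp
    also have "\<dots> \<le> 2 * d / d"
      using r d by (intro divide_right_mono) (simp_all add: dist_norm)
    finally show ?thesis using d by simp
  qed
  moreover have "1 \<le> norm (g - s)" if s: "s \<in> F" for s
  proof -
    have "r + complex_of_real d *\<^sub>C s \<in> F"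
      using s r F by (intro complex_vector.subspace_add complex_vector.subspace_scale)
    then have "d \<le> norm (f - (r + complex_of_real d *\<^sub>C s))"
      unfolding d_def dist_norm[symmetric] by (rule infdist_le)
    also have "f - (r + complex_of_real d *\<^sub>C s) = complex_of_real d *\<^sub>C (g - s)"
      by (simp add: f_eq complex_vector.scale_right_diff_distrib)
    finally show ?thesis using d by (simp add: norm_scaleC)
  qed
  moreover have "cspan (insert g F) = cspan (insert f F)"
  proof -
    have r': "r \<in> cspan (insert h F)" for h
      using r by (intro complex_vector.span_base) simp
    have h: "h \<in> cspan (insert h F)" for h
      by (intro complex_vector.span_base) simp
    have "g \<in> cspan (insert f F)"
      unfolding g_def by (intro complex_vector.span_scale complex_vector.span_diff r' h)
    moreover have "complex_of_real d *\<^sub>C g + r \<in> cspan (insert g F)"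
      by (intro complex_vector.span_scale complex_vector.span_add r' h)
    then have "f \<in> cspan (insert g F)" by (simp flip: f_eq)
    ultimately have "insert g F \<subseteq> cspan (insert f F)" "insert f F \<subseteq> cspan (insert g F)"
      by (auto intro: complex_vector.span_base)
    then show ?thesis
      unfolding complex_vector.span_eq by blast
  qed
  ultimately show ?thesis by blast
qed

text \<open>The coefficient of \<open>f\<close> depends continuously on the vector, because \<open>f\<close> has positive distance
  from \<open>F\<close>. So the coefficients along a convergent sequence converge.\<close>
lemma closed_cspan_insert:
  fixes F :: "'a::complex_normed_vector set"
  assumes F: "closed F" "csubspace F"
  shows "closed (cspan (insert f F))"
proof (cases "f \<in> F")
  case True
  with F show ?thesis by (simp add: insert_absorb cspan_subspace)
next
  case False
  define d where "d = infdist f F"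
  have ne: "F \<noteq> {}" using complex_vector.subspace_0[OF F(2)] by auto
  have d: "d > 0" unfolding d_def
    using False F ne by (intro infdist_pos_not_in_closed) auto
  have coeff: "cmod c * d \<le> norm x" if x: "x - c *\<^sub>C f \<in> F" for c x
  proof (cases "c = 0")
    case False
    have "(- 1 / c) *\<^sub>C (x - c *\<^sub>C f) \<in> F"
      using x F by (intro complex_vector.subspace_scale)
    then have "d \<le> norm (f - (- 1 / c) *\<^sub>C (x - c *\<^sub>C f))"
      unfolding d_def dist_norm[symmetric] by (rule infdist_le)
    also have "f - (- 1 / c) *\<^sub>C (x - c *\<^sub>C f) = (1 / c) *\<^sub>C x"
      using False by (simp add: complex_vector.scale_right_diff_distrib)
    also have "norm \<dots> = norm x / cmod c"
      by (simp add: norm_scaleC norm_divide)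
    finally show ?thesis using False by (simp add: field_simps)
  qed simp
  show ?thesis
    unfolding closed_sequential_limits
  proof (intro allI impI, elim conjE)
    fix X l assume X: "\<forall>n. X n \<in> cspan (insert f F)"
      and lim: "X \<longlonglongrightarrow> l"
    then have "\<forall>n. \<exists>c. X n - c *\<^sub>C f \<in> F"
      using F by (simp add: in_cspan_insert_subspace)
    then obtain c where c: "\<And>n. X n - c n *\<^sub>C f \<in> F" by metis
    have "Cauchy c"
    proof (rule CauchyI)
      fix e :: real assume "e > 0"
      then obtain N where N: "\<And>m n. m \<ge> N \<Longrightarrow> n \<ge> N \<Longrightarrow> norm (X m - X n) < e * d"
        using CauchyD[OF LIMSEQ_imp_Cauchy[OF lim], of "e * d"] d by auto
      have "norm (c m - c n) < e" if "m \<ge> N" "n \<ge> N" for m n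
      proof -
        have "(X m - X n) - (c m - c n) *\<^sub>C f = (X m - c m *\<^sub>C f) - (X n - c n *\<^sub>C f)"
          by (simp add: complex_vector.scale_left_diff_distrib)
        also have "\<dots> \<in> F" by (rule complex_vector.subspace_diff[OF F(2) c c])
        finally have "cmod (c m - c n) * d \<le> norm (X m - X n)" by (rule coeff)
        with N[OF that] have "cmod (c m - c n) * d < e * d" by linarith
        with d show ?thesis by simp
      qed
      then show "\<exists>M. \<forall>m\<ge>M. \<forall>n\<ge>M. norm (c m - c n) < e" by blast
    qed
    then obtain k where k: "c \<longlonglongrightarrow> k"
      using Cauchy_convergent convergent_def by blast
    have "(\<lambda>n. c n *\<^sub>C f) \<longlonglongrightarrow> k *\<^sub>C f"
      by (intro bounded_bilinear.tendsto[OF bounded_bilinear_scaleC] k tendsto_const)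
    with lim have "(\<lambda>n. X n - c n *\<^sub>C f) \<longlonglongrightarrow> l - k *\<^sub>C f"
      by (rule tendsto_diff)
    then have "l - k *\<^sub>C f \<in> F"
      by (rule closed_sequentially[OF F(1) c])
    with F show "l \<in> cspan (insert f F)"
      by (auto simp: in_cspan_insert_subspace)
  qed
qed

text \<open>\<open>F'\<close> is nearly contained in \<open>F\<close>, and \<open>E\<close> nearly in \<open>E'\<close>; both inclusions make the quotient
  \<open>E'/F'\<close> larger up to \<open>\<epsilon>\<close>. For the induction, a Riesz vector \<open>f\<close> is adjoined to \<open>F\<close> and a vector \<open>g\<close>
  of \<open>E'\<close> close to it to \<open>F'\<close>. Because \<open>f\<close> is almost orthogonal to \<open>F\<close>, the coefficient of \<open>g\<close> in
  an element of the enlarged \<open>F'\<close> is at most three times the norm of that element, and the closeness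
  deteriorates at most by the factor \<open>17\<close>. The bound on \<open>\<epsilon>\<close> depends
  on \<open>n\<close> only, so the roles of the two pairs of subspaces can be exchanged.\<close>
lemma reldim_ge_perturb:
  fixes F F' :: "'a::complex_normed_vector set"
  assumes "reldim_ge n E F"
    and "closed F" "csubspace F" "csubspace E" "F \<subseteq> E"
    and "csubspace F'" "csubspace E'" "F' \<subseteq> E'"
    and "0 \<le> \<epsilon>" "\<epsilon> * 17 ^ n \<le> 1 / 8"
    and "\<And>r'. r' \<in> F' \<Longrightarrow> \<exists>r\<in>F. norm (r' - r) \<le> \<epsilon> * norm r'"
    and "\<And>f. f \<in> E \<Longrightarrow> \<exists>g\<in>E'. norm (f - g) \<le> \<epsilon> * norm f"
  shows "reldim_ge n E' F'"
  using assms
proof (induction n arbitrary: F F' \<epsilon>)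
  case (Suc n)
  note F = Suc.prems(2,3) and E = Suc.prems(4,5) and F' = Suc.prems(6) and E' = Suc.prems(7,8)
    and \<epsilon> = Suc.prems(9,10) and FF = Suc.prems(11) and EE = Suc.prems(12)
  from Suc.prems(1) obtain f0 where f0: "f0 \<in> E - F" "reldim_ge n E (cspan (insert f0 F))"
    by auto
  obtain f where f: "f \<in> E - F" "norm f \<le> 2" "\<And>r. r \<in> F \<Longrightarrow> 1 \<le> norm (f - r)"
    and span: "cspan (insert f F) = cspan (insert f0 F)"
    using Riesz_reldim[OF F E f0(1)] by blast
  have "\<epsilon> * 1 \<le> \<epsilon> * 17 ^ Suc n"
    using \<epsilon>(1) by (intro mult_left_mono one_le_power) auto
  then have \<epsilon>8: "\<epsilon> \<le> 1 / 8" using \<epsilon> by linarith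
  then have \<epsilon>2: "\<epsilon> * \<epsilon> \<le> \<epsilon> / 8"
    using mult_left_mono[OF \<epsilon>8 \<epsilon>(1)] by simp
  obtain g where g: "g \<in> E'" "norm (f - g) \<le> \<epsilon> * norm f"
    using EE f by blast
  have fg: "norm (f - g) \<le> 2 * \<epsilon>"
    using g(2) mult_left_mono[OF f(2) \<epsilon>(1)] by simp
  have norm_g: "norm g \<le> 9 / 4"
    using norm_triangle_sub[of g f] fg f(2) \<epsilon>8 by (simp add: norm_minus_commute)
  \<comment> \<open>As \<open>f\<close> has distance at least \<open>1\<close> from \<open>F\<close>, the coefficient of \<open>f\<close> is a functional of norm at most \<open>1\<close>.\<close>
  have coeff: "cmod c \<le> norm (r + c *\<^sub>C f)" if "r \<in> F" for r c
  proof (cases "c = 0")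
    case False
    have "(- 1 / c) *\<^sub>C r \<in> F" using that F by (intro complex_vector.subspace_scale)
    then have "1 \<le> norm (f - (- 1 / c) *\<^sub>C r)" by (rule f(3))
    also have "f - (- 1 / c) *\<^sub>C r = (1 / c) *\<^sub>C (r + c *\<^sub>C f)"
      using False by (simp add: complex_vector.scale_right_distrib)
    also have "norm \<dots> = norm (r + c *\<^sub>C f) / cmod c"
      by (simp add: norm_scaleC norm_divide)
    finally show ?thesis using False by (simp add: field_simps)
  qed simp
  have "g \<notin> F'"
  proof
    assume "g \<in> F'"
    then obtain r where r: "r \<in> F" "norm (g - r) \<le> \<epsilon> * norm g" using FF by blast
    have "norm (f - r) \<le> norm (f - g) + norm (g - r)"
      using norm_triangle_ineq[of "f - g" "g - r"] by simp
    also have "\<dots> \<le> 2 * \<epsilon> + \<epsilon> * (9 / 4)"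
      using fg r(2) mult_left_mono[OF norm_g \<epsilon>(1)] by linarith
    also have "\<dots> < 1" using \<epsilon>8 by simp
    finally show False using f(3)[OF r(1)] by simp
  qed
  moreover have "reldim_ge n E' (cspan (insert g F'))"
  proof (rule Suc.IH[where F = "cspan (insert f F)" and \<epsilon> = "17 * \<epsilon>"])
    show "reldim_ge n E (cspan (insert f F))" using f0 span by simp
    show "closed (cspan (insert f F))" using F by (rule closed_cspan_insert)
    show "cspan (insert f F) \<subseteq> E" using f E by (intro complex_vector.span_minimal) auto
    show "cspan (insert g F') \<subseteq> E'" using g E' by (intro complex_vector.span_minimal) auto
    show "17 * \<epsilon> * 17 ^ n \<le> 1 / 8" using \<epsilon> by simp
    show "\<exists>g\<in>E'. norm (f - g) \<le> 17 * \<epsilon> * norm f" if "f \<in> E" for f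
    proof -
      have "\<epsilon> * norm f \<le> 17 * \<epsilon> * norm f"
        using \<epsilon>(1) by (intro mult_right_mono) auto
      with EE[OF that] show ?thesis using order_trans by blast
    qed
    show "\<exists>r\<in>cspan (insert f F). norm (x - r) \<le> 17 * \<epsilon> * norm x"
      if x: "x \<in> cspan (insert g F')" for x
    proof -
      from x F' obtain c where c: "x - c *\<^sub>C g \<in> F'"
        by (auto simp: in_cspan_insert_subspace)
      define r' where "r' = x - c *\<^sub>C g"
      obtain r where r: "r \<in> F" "norm (r' - r) \<le> \<epsilon> * norm r'"
        using FF c r'_def by blast
      have r': "norm r' \<le> norm x + cmod c * (9 / 4)"
        using norm_triangle_ineq4[of x "c *\<^sub>C g"] mult_left_mono[OF norm_g norm_ge_zero[of c]]
        by (simp add: r'_def norm_scaleC)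
      have "x - (r + c *\<^sub>C f) = (r' - r) - c *\<^sub>C (f - g)"
        by (simp add: r'_def complex_vector.scale_right_diff_distrib)
      then have "norm (x - (r + c *\<^sub>C f)) \<le> norm (r' - r) + cmod c * norm (f - g)"
        by (metis norm_triangle_ineq4 norm_scaleC)
      also have "\<dots> \<le> \<epsilon> * norm r' + cmod c * (2 * \<epsilon>)"
        using r fg by (intro add_mono mult_left_mono) auto
      also have "\<dots> \<le> \<epsilon> * (norm x + cmod c * (9 / 4)) + cmod c * (2 * \<epsilon>)"
        using r' \<epsilon> by (intro add_mono mult_left_mono) auto
      finally have err: "norm (x - (r + c *\<^sub>C f)) \<le> \<epsilon> * norm x + (\<epsilon> * cmod c) * (17 / 4)"
        by (simp add: algebra_simps)
      have "\<epsilon> * norm x \<le> 1 / 8 * norm x" "\<epsilon> * cmod c \<le> 1 / 8 * cmod c"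
        using \<epsilon>8 by (intro mult_right_mono; simp)+
      moreover have "cmod c \<le> norm x + norm (x - (r + c *\<^sub>C f))"
        using coeff[OF r(1), of c] norm_triangle_ineq4[of x "x - (r + c *\<^sub>C f)"] by (simp add: add.commute)
      ultimately have "cmod c \<le> 3 * norm x" using err norm_ge_zero[of x] by linarith
      then have "\<epsilon> * cmod c \<le> \<epsilon> * (3 * norm x)"
        using \<epsilon>(1) by (rule mult_left_mono)
      with err have "norm (x - (r + c *\<^sub>C f)) \<le> 17 * \<epsilon> * norm x"
        using mult_nonneg_nonneg[OF \<epsilon>(1) norm_ge_zero[of x]] by (simp add: algebra_simps)
      moreover have "r + c *\<^sub>C f \<in> cspan (insert f F)"
        using r by (intro complex_vector.span_add complex_vector.span_scale)
          (auto intro: complex_vector.span_base)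
      ultimately show ?thesis by blast
    qed
  qed (use \<epsilon> E E' in auto)
  ultimately show ?case using g by auto
qed simp

section \<open>The open mapping theorem for closed linear relations\<close>

instance complex_banach \<subseteq> banach ..

lemma csubspace_add_pair: "csubspace G \<Longrightarrow> (x, y) \<in> G \<Longrightarrow> (x', y') \<in> G \<Longrightarrow> (x + x', y + y') \<in> G"
  using complex_vector.subspace_add[of G "(x, y)" "(x', y')"] by simp

lemma csubspace_diff_pair: "csubspace G \<Longrightarrow> (x, y) \<in> G \<Longrightarrow> (x', y') \<in> G \<Longrightarrow> (x - x', y - y') \<in> G"
  using complex_vector.subspace_diff[of G "(x, y)" "(x', y')"] by simp

lemma csubspace_scale_pair: "csubspace G \<Longrightarrow> (x, y) \<in> G \<Longrightarrow> (c *\<^sub>C x, c *\<^sub>C y) \<in> G"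
  using complex_vector.subspace_scale[of G "(x, y)" c] by (simp add: scaleC_prod_def)

lemma csubspace_zero_pair: "csubspace G \<Longrightarrow> (0, 0) \<in> G"
  using complex_vector.subspace_0[of G] by (simp add: zero_prod_def)

lemma csubspace_Range:
  assumes "csubspace G"
  shows "csubspace (Range G)"
proof (rule complex_vector.subspaceI)
  show "0 \<in> Range G" using csubspace_zero_pair[OF assms] by blast
  show "x + y \<in> Range G" if "x \<in> Range G" "y \<in> Range G" for x y
    using that csubspace_add_pair[OF assms] by (meson Range.simps)
  show "c *\<^sub>C x \<in> Range G" if "x \<in> Range G" for c x
    using that csubspace_scale_pair[OF assms] by (meson Range.simps)
qed

lemma csubspace_closure:
  fixes F :: "'a::complex_normed_vector set"
  assumes F: "csubspace F"
  shows "csubspace (closure F)"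
proof (rule complex_vector.subspaceI)
  show "0 \<in> closure F"
    using complex_vector.subspace_0[OF F] closure_subset by blast
next
  fix v w assume "v \<in> closure F" "w \<in> closure F"
  then obtain f g where f: "\<And>n::nat. f n \<in> F" "f \<longlonglongrightarrow> v"
    and g: "\<And>n::nat. g n \<in> F" "g \<longlonglongrightarrow> w"
    unfolding closure_sequential by metis
  then show "v + w \<in> closure F"
    unfolding closure_sequential
    by (intro exI[of _ "\<lambda>n. f n + g n"])
      (auto intro!: tendsto_add complex_vector.subspace_add[OF F])
next
  fix c v assume "v \<in> closure F"
  then obtain f where f: "\<And>n::nat. f n \<in> F" "f \<longlonglongrightarrow> v"
    unfolding closure_sequential by metis
  then show "c *\<^sub>C v \<in> closure F"
    unfolding closure_sequential
    by (intro exI[of _ "\<lambda>n. c *\<^sub>C f n"])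
      (auto intro!: bounded_bilinear.tendsto[OF bounded_bilinear_scaleC] complex_vector.subspace_scale[OF F])
qed

text \<open>Successive approximation: the residual is halved in every step, so the corrections form an
  absolutely convergent series. The set \<open>S\<close> may be larger than the range; with its closure for \<open>S\<close>
  the lemma shows that the range is closed.\<close>
lemma solvable_if_approx_solvable:
  fixes G :: "('a::complex_banach \<times> 'b::complex_normed_vector) set"
  assumes G: "csubspace G" "closed G"
    and S: "csubspace S" "Range G \<subseteq> S" and K: "0 \<le> K"
    and approx: "\<And>y. y \<in> S \<Longrightarrow> \<exists>x y'. (x, y') \<in> G \<and> norm x \<le> K * norm y \<and> norm (y - y') \<le> norm y / 2"
    and y: "y \<in> S"
  shows "\<exists>x. (x, y) \<in> G \<and> norm x \<le> 2 * K * norm y"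
proof -
  obtain p q where pq: "\<And>y. y \<in> S \<Longrightarrow> (p y, q y) \<in> G \<and> norm (p y) \<le> K * norm y \<and> norm (y - q y) \<le> norm y / 2"
    using approx by metis
  \<comment> \<open>The residuals: \<open>p z\<close> solves for \<open>q z\<close> in place of \<open>z\<close>, which leaves \<open>z - q z\<close>.\<close>
  define r where "r = rec_nat y (\<lambda>_ z. z - q z)"
  have r: "r 0 = y" "r (Suc n) = r n - q (r n)" for n by (simp_all add: r_def)
  have rS: "r n \<in> S" for n
  proof (induction n)
    case (Suc n)
    then have "q (r n) \<in> S" using pq S(2) by blast
    with Suc show ?case by (simp add: r complex_vector.subspace_diff[OF S(1)])
  qed (simp add: r y)
  have r_norm: "norm (r n) \<le> norm y * (1 / 2) ^ n" for n
  proof (induction n)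
    case (Suc n)
    then show ?case using pq[OF rS, of n] by (simp add: r)
  qed (simp add: r)
  have p_norm: "norm (p (r n)) \<le> K * norm y * (1 / 2) ^ n" for n
  proof -
    have "norm (p (r n)) \<le> K * norm (r n)" using pq[OF rS] by blast
    also have "\<dots> \<le> K * (norm y * (1 / 2) ^ n)" using K r_norm by (intro mult_left_mono)
    finally show ?thesis by simp
  qed
  have geo: "(\<lambda>n. K * norm y * (1 / 2) ^ n) sums (K * norm y * 2)"
    using sums_mult[OF geometric_sums[of "1 / 2 :: real"]] by simp
  have sum_norm: "summable (\<lambda>n. norm (p (r n)))"
    by (rule summable_comparison_test'[OF sums_summable[OF geo]]) (use p_norm in simp)
  then have summable: "summable (\<lambda>n. p (r n))" by (rule summable_norm_cancel)
  have partial: "(\<Sum>i<n. q (r i)) = y - r n" for n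
    by (induction n) (simp_all add: r)
  have in_G: "((\<Sum>i<n. p (r i)), y - r n) \<in> G" for n
  proof (induction n)
    case 0
    then show ?case using csubspace_zero_pair[OF G(1)] by (simp add: r)
  next
    case (Suc n)
    have "(p (r n), q (r n)) \<in> G" using pq[OF rS] by blast
    from csubspace_add_pair[OF G(1) Suc this] show ?case by (simp add: r algebra_simps)
  qed
  have "r \<longlonglongrightarrow> 0"
  proof (rule Lim_null_comparison)
    show "(\<lambda>n. norm y * (1 / 2) ^ n) \<longlonglongrightarrow> 0"
      by (intro tendsto_mult_right_zero LIMSEQ_power_zero) simp
  qed (simp add: r_norm)
  then have "(\<lambda>n. ((\<Sum>i<n. p (r i)), y - r n)) \<longlonglongrightarrow> ((\<Sum>i. p (r i)), y - 0)"
    by (intro tendsto_Pair tendsto_diff tendsto_const summable_LIMSEQ summable)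
  from closed_sequentially[OF G(2) in_G this] have "((\<Sum>i. p (r i)), y) \<in> G" by simp
  moreover have "norm (\<Sum>i. p (r i)) \<le> 2 * K * norm y"
  proof -
    have "norm (\<Sum>i. p (r i)) \<le> (\<Sum>i. norm (p (r i)))"
      using sum_norm by (rule summable_norm)
    also have "\<dots> \<le> (\<Sum>n. K * norm y * (1 / 2) ^ n)"
      using p_norm sum_norm sums_summable[OF geo] by (intro suminf_le) auto
    also have "\<dots> = 2 * K * norm y" using sums_unique[OF geo] by simp
    finally show ?thesis .
  qed
  ultimately show ?thesis by blast
qed

lemma closed_Range_if_bounded_below:
  fixes G :: "('a::complex_banach \<times> 'b::complex_normed_vector) set"
  assumes G: "csubspace G" "closed G" and K: "0 \<le> K"
    and bound: "\<And>y. y \<in> Range G \<Longrightarrow> \<exists>x. (x, y) \<in> G \<and> norm x \<le> K * norm y"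
  shows "closed (Range G)"
proof -
  have "y \<in> Range G" if y: "y \<in> closure (Range G)" for y
  proof -
    have "\<exists>x. (x, y) \<in> G \<and> norm x \<le> 2 * (2 * K) * norm y"
    proof (rule solvable_if_approx_solvable[OF G csubspace_closure[OF csubspace_Range[OF G(1)]] closure_subset _ _ y])
      fix y assume y: "y \<in> closure (Range G)"
      show "\<exists>x y'. (x, y') \<in> G \<and> norm x \<le> 2 * K * norm y \<and> norm (y - y') \<le> norm y / 2"
      proof (cases "y = 0")
        case True
        then show ?thesis using csubspace_zero_pair[OF G(1)] by (intro exI[of _ 0]) simp
      next
        case False
        then obtain y' where y': "y' \<in> Range G" "dist y' y < norm y / 2"
          using y unfolding closure_approachable by (meson half_gt_zero zero_less_norm_iff)
        then obtain x where x: "(x, y') \<in> G" "norm x \<le> K * norm y'" using bound by blast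
        have "norm y' \<le> 2 * norm y"
          using norm_triangle_sub[of y' y] y'(2) norm_ge_zero[of y] unfolding dist_norm by linarith
        then have "norm x \<le> K * (2 * norm y)"
          using x(2) mult_left_mono[OF _ K] order_trans by blast
        with x(1) y'(2) show ?thesis
          by (intro exI[of _ x] exI[of _ y']) (auto simp: dist_norm norm_minus_commute)
      qed
    qed (use K in simp)
    then show ?thesis by blast
  qed
  then show ?thesis
    using closure_subset_eq by blast
qed

text \<open>By Baire's theorem in the complete space \<open>Range G\<close>, the image of some ball is dense in a ball of
  \<open>Range G\<close> around a point \<open>y0\<close>. Differences of two such image points approximate all small elements of
  \<open>Range G\<close>, and all elements after rescaling.\<close>
theorem open_mapping_relation:
  fixes G :: "('a::complex_banach \<times> 'b::complex_banach) set"
  assumes G: "csubspace G" "closed G" and R: "closed (Range G)"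
  shows "\<exists>K\<ge>0. \<forall>y\<in>Range G. \<exists>x. (x, y) \<in> G \<and> norm x \<le> K * norm y"
proof -
  define E where "E n = G `` {x. norm x \<le> real n}" for n :: nat
  let ?X = "top_of_set (Range G)"
  have E_sub: "E n \<subseteq> Range G" for n by (auto simp: E_def)
  then have clE: "closure (E n) \<subseteq> Range G" for n using R by (rule closure_minimal)
  have "\<Union>(range (\<lambda>n. closure (E n))) = Range G"
  proof
    show "Range G \<subseteq> \<Union>(range (\<lambda>n. closure (E n)))"
    proof
      fix y assume "y \<in> Range G"
      then obtain x where x: "(x, y) \<in> G" by blast
      obtain n :: nat where "norm x \<le> real n" using real_arch_simple by blast
      with x have "y \<in> E n" by (auto simp: E_def)
      then show "y \<in> \<Union>(range (\<lambda>n. closure (E n)))" using closure_subset by blast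
    qed
  qed (use clE in blast)
  then have "?X interior_of \<Union>(range (\<lambda>n. closure (E n))) = Range G"
    by (metis interior_of_topspace topspace_euclidean_subtopology)
  moreover have "Range G \<noteq> {}" using csubspace_zero_pair[OF G(1)] by blast
  moreover have "completely_metrizable_space ?X"
    by (rule completely_metrizable_space_closedin[OF completely_metrizable_space_euclidean])
      (use R in simp)
  ultimately have "\<exists>n. \<not> (closedin ?X (closure (E n)) \<and> ?X interior_of closure (E n) = {})"
    using Baire_category_alt[of ?X "range (\<lambda>n. closure (E n))"] by auto
  moreover have "closedin ?X (closure (E n))" for n
    using clE by (intro closed_subset) auto
  ultimately obtain n y0 where y0: "y0 \<in> ?X interior_of closure (E n)" by blast
  then obtain U where U: "openin ?X U" "y0 \<in> U" "U \<subseteq> closure (E n)"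
    by (auto simp: interior_of_def)
  then obtain e where e: "e > 0" "ball y0 e \<inter> Range G \<subseteq> closure (E n)"
    using openin_contains_ball by (metis order_trans)
  have y0R: "y0 \<in> Range G" using U clE by blast
  have approx: "\<exists>x y'. (x, y') \<in> G \<and> norm x \<le> (4 * real n / e) * norm y \<and> norm (y - y') \<le> norm y / 2"
    if y: "y \<in> Range G" for y
  proof (cases "y = 0")
    case True
    then show ?thesis using csubspace_zero_pair[OF G(1)] by (intro exI[of _ 0]) simp
  next
    case False
    define t where "t = e / (2 * norm y)"
    have t: "t > 0" "t * norm y = e / 2" using e False by (simp_all add: t_def)
    define v where "v = complex_of_real t *\<^sub>C y"
    have v: "v \<in> Range G" "norm v = e / 2"
      using csubspace_scale_pair[OF G(1)] y t by (auto simp: v_def norm_scaleC)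
    have "y0 + v \<in> closure (E n)"
      using e v complex_vector.subspace_add[OF csubspace_Range[OF G(1)] y0R v(1)]
      by (auto simp: dist_norm)
    then obtain e1 where e1: "e1 \<in> E n" "dist e1 (y0 + v) < e / 8"
      using e(1) unfolding closure_approachable by (meson divide_pos_pos zero_less_numeral)
    have "y0 \<in> closure (E n)" using U by blast
    then obtain e2 where e2: "e2 \<in> E n" "dist e2 y0 < e / 8"
      using e(1) unfolding closure_approachable by (meson divide_pos_pos zero_less_numeral)
    from e1 e2 obtain x1 x2 where x: "(x1, e1) \<in> G" "norm x1 \<le> real n" "(x2, e2) \<in> G" "norm x2 \<le> real n"
      by (auto simp: E_def)
    have "norm (v - (e1 - e2)) \<le> dist e1 (y0 + v) + dist e2 y0"
      using norm_triangle_ineq4[of "e2 - y0" "e1 - (y0 + v)"] by (simp add: dist_norm algebra_simps)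
    then have close: "norm (v - (e1 - e2)) \<le> e / 4" using e1 e2 by simp
    let ?s = "complex_of_real (1 / t)"
    have "(?s *\<^sub>C (x1 - x2), ?s *\<^sub>C (e1 - e2)) \<in> G"
      by (intro csubspace_scale_pair csubspace_diff_pair G x)
    moreover have "norm (?s *\<^sub>C (x1 - x2)) \<le> (4 * real n / e) * norm y"
    proof -
      have "norm (?s *\<^sub>C (x1 - x2)) = norm (x1 - x2) / t"
        using t by (simp only: norm_scaleC norm_of_real) simp
      also have "\<dots> \<le> (2 * real n) / t"
        using norm_triangle_ineq4[of x1 x2] x t by (intro divide_right_mono) auto
      also have "\<dots> = (4 * real n / e) * norm y"
        using e by (simp add: t_def field_simps)
      finally show ?thesis .
    qed
    moreover have "norm (y - ?s *\<^sub>C (e1 - e2)) \<le> norm y / 2"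
    proof -
      have "y = ?s *\<^sub>C v" using t by (simp add: v_def flip: of_real_mult)
      then have "y - ?s *\<^sub>C (e1 - e2) = ?s *\<^sub>C (v - (e1 - e2))"
        by (simp only: complex_vector.scale_right_diff_distrib)
      then have "norm (y - ?s *\<^sub>C (e1 - e2)) = norm (v - (e1 - e2)) / t"
        using t by (simp only: norm_scaleC norm_of_real) simp
      also have "\<dots> \<le> (e / 4) / t" using close t by (intro divide_right_mono) auto
      also have "\<dots> = norm y / 2" using e False by (simp add: t_def field_simps)
      finally show ?thesis .
    qed
    ultimately show ?thesis by blast
  qed
  have "\<exists>x. (x, y) \<in> G \<and> norm x \<le> 2 * (4 * real n / e) * norm y" if "y \<in> Range G"
    for y
    by (rule solvable_if_approx_solvable[OF G csubspace_Range[OF G(1)] order_refl _ approx that])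
      (use e in auto)
  then show ?thesis using e by (intro exI[of _ "2 * (4 * real n / e)"]) auto
qed

section \<open>Regular pencils of linear relations\<close>

lemma rel_pencil_iff:
  "(x, y) \<in> rel_pencil A l B \<longleftrightarrow> (\<exists>b. (x, b) \<in> B \<and> (x, y + l *\<^sub>C b) \<in> A)"
  unfolding rel_pencil_def by (auto simp: algebra_simps)

lemma rel_kernel_iff: "x \<in> rel_kernel A \<longleftrightarrow> (x, 0) \<in> A"
  by (auto simp: rel_kernel_def)

lemma csubspace_rel_pencil:
  assumes "csubspace A" "csubspace B"
  shows "csubspace (rel_pencil A l B)"
proof (rule complex_vector.subspaceI)
  show "0 \<in> rel_pencil A l B"
    using assms by (auto simp: zero_prod_def rel_pencil_iff intro!: exI[of _ 0] csubspace_zero_pair)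
next
  fix u v assume "u \<in> rel_pencil A l B" "v \<in> rel_pencil A l B"
  then obtain x y b x' y' b' where uv: "u = (x, y)" "v = (x', y')"
    and *: "(x, b) \<in> B" "(x, y + l *\<^sub>C b) \<in> A" "(x', b') \<in> B" "(x', y' + l *\<^sub>C b') \<in> A"
    by (cases u; cases v) (auto simp: rel_pencil_iff)
  have "(x + x', b + b') \<in> B"
    using * assms by (intro csubspace_add_pair)
  moreover have "(x + x', (y + y') + l *\<^sub>C (b + b')) \<in> A"
    using csubspace_add_pair[OF assms(1) *(2,4)] by (simp add: scaleC_add_right algebra_simps)
  ultimately show "u + v \<in> rel_pencil A l B" by (auto simp: uv rel_pencil_iff)
next
  fix k u assume "u \<in> rel_pencil A l B"
  then obtain x y b where u: "u = (x, y)" and *: "(x, b) \<in> B" "(x, y + l *\<^sub>C b) \<in> A"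
    by (cases u) (auto simp: rel_pencil_iff)
  have "(k *\<^sub>C x, k *\<^sub>C b) \<in> B"
    using * assms by (intro csubspace_scale_pair)
  moreover have "(k *\<^sub>C x, k *\<^sub>C y + l *\<^sub>C k *\<^sub>C b) \<in> A"
    using csubspace_scale_pair[OF assms(1) *(2), of k]
    by (simp add: scaleC_add_right mult.commute)
  ultimately show "k *\<^sub>C u \<in> rel_pencil A l B"
    by (auto simp: u rel_pencil_iff scaleC_prod_def)
qed

lemma csubspace_rel_kernel:
  assumes "csubspace G"
  shows "csubspace (rel_kernel G)"
proof (rule complex_vector.subspaceI)
  show "0 \<in> rel_kernel G" using csubspace_zero_pair[OF assms] by (simp add: rel_kernel_iff)
  show "x + y \<in> rel_kernel G" if "x \<in> rel_kernel G" "y \<in> rel_kernel G" for x y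
    using csubspace_add_pair[OF assms, of x 0 y 0] that by (simp add: rel_kernel_iff)
  show "c *\<^sub>C x \<in> rel_kernel G" if "x \<in> rel_kernel G" for c x
    using csubspace_scale_pair[OF assms, of x 0] that by (simp add: rel_kernel_iff)
qed

lemma csubspace_Image:
  assumes G: "csubspace G" and M: "csubspace M"
  shows "csubspace (G `` M)"
proof (rule complex_vector.subspaceI)
  show "0 \<in> G `` M" using csubspace_zero_pair[OF G] complex_vector.subspace_0[OF M] by blast
  show "x + y \<in> G `` M" if "x \<in> G `` M" "y \<in> G `` M" for x y
    using that csubspace_add_pair[OF G] complex_vector.subspace_add[OF M] by (meson Image_iff)
  show "c *\<^sub>C x \<in> G `` M" if "x \<in> G `` M" for c x
    using that csubspace_scale_pair[OF G] complex_vector.subspace_scale[OF M] by (meson Image_iff)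
qed

lemma csubspace_converse: "csubspace G \<Longrightarrow> csubspace (G\<inverse>)"
  by (rule complex_vector.subspaceI)
    (auto simp: scaleC_prod_def zero_prod_def intro: csubspace_add_pair csubspace_scale_pair csubspace_zero_pair)

lemma csubspace_M_seq: "csubspace A \<Longrightarrow> csubspace B \<Longrightarrow> csubspace (M_seq A B n)"
  by (induction n) (simp_all add: csubspace_Image csubspace_converse)

text \<open>If every preimage can be improved by a factor \<open>\<theta> < 1\<close> up to a multiple of \<open>\<parallel>y\<parallel>\<close>, iteration
  makes the contribution of the initial preimage smaller than \<open>\<parallel>y\<parallel>\<close>.\<close>
lemma bounded_below_if_contraction:
  fixes G :: "('a::complex_normed_vector \<times> 'b::complex_normed_vector) set"
  assumes G: "csubspace G" and \<theta>: "0 \<le> \<theta>" "\<theta> < 1" and K: "0 \<le> K"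
    and improve: "\<And>x y. (x, y) \<in> G \<Longrightarrow> \<exists>x'. (x', y) \<in> G \<and> norm x' \<le> \<theta> * norm x + K * norm y"
    and xy: "(x, y) \<in> G"
  shows "\<exists>x. (x, y) \<in> G \<and> norm x \<le> (K / (1 - \<theta>) + 1) * norm y"
proof (cases "y = 0")
  case True
  then show ?thesis using csubspace_zero_pair[OF G] by (intro exI[of _ 0]) simp
next
  case False
  let ?D = "K / (1 - \<theta>)"
  have D: "\<theta> * ?D + K = ?D" using \<theta> by (simp add: field_simps)
  have iter: "\<exists>x'. (x', y) \<in> G \<and> norm x' \<le> \<theta> ^ n * norm x + ?D * norm y"
    for n
  proof (induction n)
    case 0
    then show ?case using xy K \<theta> by (intro exI[of _ x]) simp
  next
    case (Suc n)
    then obtain x' where x': "(x', y) \<in> G" "norm x' \<le> \<theta> ^ n * norm x + ?D * norm y"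
      by blast
    obtain x'' where x'': "(x'', y) \<in> G" "norm x'' \<le> \<theta> * norm x' + K * norm y"
      using improve[OF x'(1)] by blast
    have "norm x'' \<le> \<theta> * (\<theta> ^ n * norm x + ?D * norm y) + K * norm y"
      using x''(2) mult_left_mono[OF x'(2) \<theta>(1)] by linarith
    also have "\<dots> = \<theta> ^ Suc n * norm x + (\<theta> * ?D + K) * norm y"
      by (simp only: power_Suc algebra_simps)
    finally show ?case using x''(1) D by auto
  qed
  have "(\<lambda>n. \<theta> ^ n * norm x) \<longlonglongrightarrow> 0"
    using \<theta> by (intro tendsto_mult_left_zero LIMSEQ_power_zero) simp
  then have "eventually (\<lambda>n. \<theta> ^ n * norm x < norm y) sequentially"
    using False by (intro order_tendstoD) auto
  then obtain n where "\<theta> ^ n * norm x < norm y"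
    by (meson eventually_sequentially order_refl)
  with iter[of n] obtain x' where "(x', y) \<in> G" "norm x' \<le> norm y + ?D * norm y" by force
  then show ?thesis by (intro exI[of _ x']) (simp add: algebra_simps)
qed

lemma enat_eqI:
  assumes "\<And>n. enat n \<le> x \<longleftrightarrow> enat n \<le> y"
  shows "x = y"
proof (rule antisym)
  have le: "u \<le> v" if "\<And>n. enat n \<le> u \<Longrightarrow> enat n \<le> v" for u v
  proof (cases u)
    case infinity
    then have "enat n \<le> v" for n using that by simp
    then show ?thesis by (metis Suc_ile_eq enat.exhaust enat_ord_code(3) less_irrefl)
  qed (use that in simp)
  show "x \<le> y" "y \<le> x" using assms by (auto intro: le)
qed

text \<open>The hypotheses in terms of representatives, with the norms of \<open>X\<close> and \<open>Y\<close> in place of quotient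
  norms. Here \<open>c\<close> is slightly larger than \<open>1/\<gamma>(\<A>)\<close>, and \<open>\<sigma>\<close> slightly larger than in the norm inequality
  for \<open>\<B>\<close>; the slack makes up for distances and lower bounds that are not attained. In \<open>B_bound\<close> one
  \<open>b\<close> serves all \<open>a' \<in> \<A>(x)\<close>, so that \<open>a'\<close> may later be chosen in terms of \<open>b\<close>.\<close>
locale regular_pencil =
  fixes A B :: "('a::complex_banach \<times> 'b::complex_banach) set"
    and \<sigma> \<tau> c \<rho> :: real
  assumes A: "csubspace A" "closed A" and B: "csubspace B" "closed B"
    and B0_sub_A0: "(0, b) \<in> B \<Longrightarrow> (0, b) \<in> A"
    and \<sigma>: "0 \<le> \<sigma>"
      and \<tau>: "0 \<le> \<tau>" and c: "0 < c" and \<rho>: "0 \<le> \<rho>"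
    and small: "\<rho> * (3 * \<sigma> * c + \<tau>) < 1"
    and near_kernel: "(x, a) \<in> A \<Longrightarrow> \<exists>x0. (x0, 0) \<in> A \<and> norm (x - x0) \<le> c * norm a"
    and B_bound: "(x, a) \<in> A \<Longrightarrow>
      \<exists>b. (x, b) \<in> B \<and> (\<forall>a'. (x, a') \<in> A \<longrightarrow> norm b \<le> \<sigma> * norm x + \<tau> * norm a')"
    and kernel_sub_M_seq: "(x, 0) \<in> A \<Longrightarrow> x \<in> M_seq A B n"
begin

abbreviation pencil :: "complex \<Rightarrow> ('a \<times> 'b) set" where
  "pencil l \<equiv> rel_pencil A l B"

definition M_inf :: "'a set" where
  "M_inf = (\<Inter>n. M_seq A B n)"

text \<open>The sum of the geometric series that dominates the Neumann series in \<open>pencil_solvable\<close>.\<close>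
definition solve_bound :: real where
  "solve_bound = c / (1 - \<rho> * (\<sigma> * c + \<tau>))"

lemma csubspace_pencil: "csubspace (pencil l)"
  using A B by (intro csubspace_rel_pencil)

lemma rho_small: "\<rho> * \<sigma> * c \<ge> 0" "\<rho> * \<tau> \<ge> 0" "3 * (\<rho> * \<sigma> * c) + \<rho> * \<tau> < 1"
  using \<rho> \<sigma> \<tau> c small by (simp_all add: algebra_simps)

lemma denominator_pos: "\<rho> * (\<sigma> * c + \<tau>) < 1" "\<rho> * \<tau> < 1"
  using rho_small by (simp_all add: algebra_simps)

lemma tau_cmod_le: "cmod m \<le> \<rho> \<Longrightarrow> \<tau> * cmod m \<le> \<rho> * \<tau>"
  using mult_left_mono[of "cmod m" \<rho> \<tau>] \<tau> by (simp add: mult.commute)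

lemma solve_bound_nonneg: "0 \<le> solve_bound"
  using denominator_pos c by (simp add: solve_bound_def)

lemma A_shift:
  assumes "(x, a) \<in> A" "(x, b) \<in> B" "(x, b') \<in> B"
  shows "(x, a + l *\<^sub>C (b' - b)) \<in> A"
proof -
  have "(0, b' - b) \<in> B" using csubspace_diff_pair[OF B(1) assms(3,2)] by simp
  then have "(l *\<^sub>C 0, l *\<^sub>C (b' - b)) \<in> A"
    using csubspace_scale_pair[OF A(1) B0_sub_A0] by blast
  with csubspace_add_pair[OF A(1) assms(1)] show ?thesis by fastforce
qed

text \<open>As \<open>\<B>(0) \<subseteq> \<A>(0)\<close>, membership in the pencil may be tested with any element of \<open>\<B>(x)\<close>.\<close>
lemma pencil_iff:
  assumes "(x, b) \<in> B"
  shows "(x, y) \<in> pencil l \<longleftrightarrow> (x, y + l *\<^sub>C b) \<in> A"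
proof
  assume "(x, y) \<in> pencil l"
  then obtain b' where "(x, b') \<in> B" "(x, y + l *\<^sub>C b') \<in> A"
    by (auto simp: rel_pencil_iff)
  from A_shift[OF this(2,1) assms, of l] show "(x, y + l *\<^sub>C b) \<in> A"
    by (simp add: complex_vector.scale_right_diff_distrib)
qed (use assms in \<open>auto simp: rel_pencil_iff\<close>)

text \<open>The element \<open>y + \<lambda>b\<close> of \<open>\<A>(x)\<close> involves the chosen \<open>b\<close> itself; its contribution \<open>\<tau>\<bar>\<lambda>\<bar>\<parallel>b\<parallel>\<close> is
  absorbed into the left-hand side.\<close>
lemma pencil_B_bound:
  assumes "(x, y) \<in> pencil l"
  shows "\<exists>b. (x, b) \<in> B \<and> (1 - \<tau> * cmod l) * norm b \<le> \<sigma> * norm x + \<tau> * norm y"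
proof -
  obtain b0 where "(x, y + l *\<^sub>C b0) \<in> A" using assms by (auto simp: rel_pencil_iff)
  from B_bound[OF this] obtain b where b: "(x, b) \<in> B"
    "\<And>a'. (x, a') \<in> A \<Longrightarrow> norm b \<le> \<sigma> * norm x + \<tau> * norm a'"
      by blast
  have "norm b \<le> \<sigma> * norm x + \<tau> * norm (y + l *\<^sub>C b)"
    using b assms by (simp add: pencil_iff)
  also have "\<dots> \<le> \<sigma> * norm x + \<tau> * (norm y + cmod l * norm b)"
    using mult_left_mono[OF norm_triangle_ineq[of y "l *\<^sub>C b"] \<tau>] by (simp add: norm_scaleC)
  finally show ?thesis using b(1) by (auto simp: algebra_simps)
qed

lemma kernel_sub_M_inf: "(x, 0) \<in> A \<Longrightarrow> x \<in> M_inf"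
  using kernel_sub_M_seq by (auto simp: M_inf_def)

lemma csubspace_M_inf: "csubspace M_inf"
  unfolding M_inf_def using csubspace_M_seq[OF A(1) B(1)]
  by (intro complex_vector.subspace_Inter) auto

text \<open>For each \<open>n\<close> there is a preimage of \<open>b\<close> in \<open>M\<^sub>n\<close>. Two preimages differ by an element of \<open>N(\<A>)\<close>,
  which is contained in every \<open>M\<^sub>n\<close>, so a single preimage lies in all of them.\<close>
lemma M_inf_step:
  assumes w: "w \<in> M_inf" and b: "(w, b) \<in> B"
  shows "\<exists>v\<in>M_inf. (v, b) \<in> A"
proof -
  have ex: "\<exists>v\<in>M_seq A B n. (v, b) \<in> A" for n
  proof -
    have "w \<in> M_seq A B (Suc n)" using w unfolding M_inf_def by blast
    then obtain b' v where v: "(w, b') \<in> B" "(v, b') \<in> A" "v \<in> M_seq A B n" by auto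
    have "(0, b - b') \<in> A"
      using csubspace_diff_pair[OF B(1) b v(1)] B0_sub_A0 by simp
    from csubspace_add_pair[OF A(1) v(2) this] v(3) show ?thesis by auto
  qed
  obtain v where v: "(v, b) \<in> A" using ex by blast
  have "v \<in> M_seq A B n" for n
  proof -
    obtain v' where v': "v' \<in> M_seq A B n" "(v', b) \<in> A" using ex by blast
    have "v - v' \<in> M_seq A B n"
      using csubspace_diff_pair[OF A(1) v v'(2)] kernel_sub_M_seq by simp
    from complex_vector.subspace_add[OF csubspace_M_seq[OF A(1) B(1)] this v'(1)] show ?thesis by simp
  qed
  with v show ?thesis by (auto simp: M_inf_def)
qed

text \<open>For \<open>\<lambda> \<noteq> 0\<close> and \<open>x\<close> in the kernel, some \<open>b \<in> \<B> x\<close> lies in \<open>\<A>(x/\<lambda>)\<close>, so \<open>x \<in> M\<^sub>n\<close> implies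
  \<open>x \<in> M\<^sub>n\<^sub>+\<^sub>1\<close>.\<close>
lemma kernel_pencil_sub_M_inf:
  assumes "x \<in> rel_kernel (pencil l)"
  shows "x \<in> M_inf"
proof (cases "l = 0")
  case True
  with assms show ?thesis by (auto simp: rel_kernel_iff rel_pencil_iff intro: kernel_sub_M_inf)
next
  case False
  from assms obtain b where b: "(x, b) \<in> B" "(x, l *\<^sub>C b) \<in> A"
    by (auto simp: rel_kernel_iff rel_pencil_iff)
  have "((1 / l) *\<^sub>C x, b) \<in> A"
    using csubspace_scale_pair[OF A(1) b(2), of "1 / l"] False by simp
  then have "x \<in> M_seq A B n" for n
  proof (induction n)
    case (Suc n)
    have "(1 / l) *\<^sub>C x \<in> M_seq A B n"
      using Suc by (intro complex_vector.subspace_scale csubspace_M_seq A B)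
    with Suc.prems b(1) show ?case by auto
  qed simp
  then show ?thesis by (simp add: M_inf_def)
qed

text \<open>The Neumann series described at the beginning. The \<open>z n = (w\<^sub>n, a\<^sub>n)\<close> below satisfy
  \<open>a\<^sub>n \<in> \<A> w\<^sub>n\<close>, \<open>a\<^sub>0 = y\<close> and \<open>a\<^sub>n\<^sub>+\<^sub>1 \<in> \<B> w\<^sub>n\<close>, so that the sums telescope. Membership of the \<open>w\<^sub>n\<close> in
  \<open>M_inf\<close> keeps the recursion going.\<close>
lemma pencil_solvable:
  assumes l: "cmod l \<le> \<rho>" and v: "v \<in> M_inf" "(v, y) \<in> A"
  shows "\<exists>w. (w, y) \<in> pencil l \<and> norm w \<le> solve_bound * norm y"
proof -
  let ?k = "\<sigma> * c + \<tau>"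
  have k: "0 \<le> ?k" using \<sigma> \<tau> c by simp
  define good where "good z \<longleftrightarrow> fst z \<in> M_inf \<and> z \<in> A \<and> norm (fst z) \<le> c * norm (snd z)"
    for z
  \<comment> \<open>A preimage in \<open>M_inf\<close> remains there when it is shortened by an element of \<open>N(\<A>)\<close>.\<close>
  have start: "\<exists>w. good (w, a)" if u: "u \<in> M_inf" "(u, a) \<in> A" for u a
  proof -
    obtain x0 where x0: "(x0, 0) \<in> A" "norm (u - x0) \<le> c * norm a"
      using near_kernel[OF u(2)] by blast
    have "u - x0 \<in> M_inf"
      using complex_vector.subspace_diff[OF csubspace_M_inf u(1) kernel_sub_M_inf[OF x0(1)]] .
    moreover have "(u - x0, a) \<in> A" using csubspace_diff_pair[OF A(1) u(2) x0(1)] by simp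
    ultimately show ?thesis using x0 by (auto simp: good_def)
  qed
  \<comment> \<open>One term of the series yields the next: \<open>b \<in> \<B> w\<close> is controlled by \<open>w\<close> and \<open>a\<close>, and has a preimage
    under \<open>\<A>\<close> in \<open>M_inf\<close>.\<close>
  have step: "\<exists>z'. good z' \<and> (fst z, snd z') \<in> B \<and> norm (snd z') \<le> ?k * norm (snd z)" if good: "good z"
    for z
  proof -
    obtain w a where z: "z = (w, a)" "w \<in> M_inf" "(w, a) \<in> A" "norm w \<le> c * norm a"
      using good by (cases z) (auto simp: good_def)
    obtain b where b: "(w, b) \<in> B" "norm b \<le> \<sigma> * norm w + \<tau> * norm a"
      using B_bound[OF z(3)] z(3) by blast
    obtain u where "u \<in> M_inf" "(u, b) \<in> A" using M_inf_step[OF z(2) b(1)] by blast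
    from start[OF this] obtain w' where "good (w', b)" by blast
    moreover have "norm b \<le> ?k * norm a"
      using b(2) mult_left_mono[OF z(4) \<sigma>] by (simp add: algebra_simps)
    ultimately show ?thesis using z b by (intro exI[of _ "(w', b)"]) auto
  qed
  obtain w0 where w0: "good (w0, y)" using start[OF v] by blast
  have "\<exists>z. \<forall>n. (good (z n) \<and> (n = 0 \<longrightarrow> z n = (w0, y))) \<and>
      (fst (z n), snd (z (Suc n))) \<in> B \<and> norm (snd (z (Suc n))) \<le> ?k * norm (snd (z n))"
    by (rule dependent_nat_choice) (use w0 step in blast)+
  then obtain z where zgood: "\<And>n. good (z n)" and z0: "z 0 = (w0, y)"
    and zB: "\<And>n. (fst (z n), snd (z (Suc n))) \<in> B"
      and zk: "\<And>n. norm (snd (z (Suc n))) \<le> ?k * norm (snd (z n))"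
    by blast
  define w where "w n = l ^ n *\<^sub>C fst (z n)" for n
  define a where "a n = l ^ n *\<^sub>C snd (z n)" for n
  define b where "b n = l ^ n *\<^sub>C snd (z (Suc n))" for n
  have zA: "(fst (z n), snd (z n)) \<in> A" and zc: "norm (fst (z n)) \<le> c * norm (snd (z n))"
    for n
    using zgood[of n] by (auto simp: good_def)
  have wA: "(w n, a n) \<in> A" and wB: "(w n, b n) \<in> B" for n
    unfolding w_def a_def b_def by (intro csubspace_scale_pair A B zA zB)+
  have ab: "a (Suc n) = l *\<^sub>C b n" for n by (simp add: a_def b_def)
  let ?q = "\<rho> * ?k"
  have q: "0 \<le> ?q" "?q < 1" using \<rho> k denominator_pos by simp_all
  have a_norm: "norm (a n) \<le> norm y * ?q ^ n" for n
  proof (induction n)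
    case 0
    then show ?case by (simp add: a_def z0)
  next
    case (Suc n)
    have "norm (a (Suc n)) = cmod l * (cmod l ^ n * norm (snd (z (Suc n))))"
      by (simp add: a_def norm_scaleC norm_power norm_mult)
    also have "\<dots> \<le> \<rho> * (cmod l ^ n * (?k * norm (snd (z n))))"
      using l \<rho> zk by (intro mult_mono mult_left_mono) auto
    also have "\<dots> = ?q * norm (a n)" by (simp add: a_def norm_scaleC norm_power)
    also have "\<dots> \<le> ?q * (norm y * ?q ^ n)" using Suc q by (intro mult_left_mono)
    finally show ?case by (simp add: mult_ac)
  qed
  have w_norm: "norm (w n) \<le> c * norm y * ?q ^ n" for n
  proof -
    have "norm (w n) \<le> c * norm (a n)"
      using mult_left_mono[OF zc, of "cmod l ^ n" n] by (simp add: w_def a_def norm_scaleC norm_power mult_ac)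
    also have "\<dots> \<le> c * (norm y * ?q ^ n)" using a_norm c by (intro mult_left_mono) auto
    finally show ?thesis by simp
  qed
  have b_norm: "norm (b n) \<le> ?k * norm y * ?q ^ n" for n
  proof -
    have "norm (b n) \<le> ?k * norm (a n)"
      using mult_left_mono[OF zk, of "cmod l ^ n" n] by (simp add: b_def a_def norm_scaleC norm_power mult_ac)
    also have "\<dots> \<le> ?k * (norm y * ?q ^ n)" using a_norm k by (intro mult_left_mono) auto
    finally show ?thesis by simp
  qed
  have geo: "(\<lambda>n. K * ?q ^ n) sums (K / (1 - ?q))" for K
    using sums_mult[OF geometric_sums[of ?q], of K] q by simp
  have sw: "summable (\<lambda>n. norm (w n))"
    and sa: "summable (\<lambda>n. norm (a n))" and sb: "summable (\<lambda>n. norm (b n))"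
    using w_norm a_norm b_norm
    by (auto intro!: summable_comparison_test'[OF sums_summable[OF geo]])
  note s = sw[THEN summable_norm_cancel] sa[THEN summable_norm_cancel] sb[THEN summable_norm_cancel]
  have partial_A: "((\<Sum>i<n. w i), (\<Sum>i<n. a i)) \<in> A" for n
    by (induction n) (auto intro: csubspace_add_pair[OF A(1)] csubspace_zero_pair[OF A(1)] wA)
  have sumA: "((\<Sum>n. w n), (\<Sum>n. a n)) \<in> A"
    by (rule closed_sequentially[OF A(2) partial_A tendsto_Pair[OF summable_LIMSEQ[OF s(1)] summable_LIMSEQ[OF s(2)]]])
  have partial_B: "((\<Sum>i<n. w i), (\<Sum>i<n. b i)) \<in> B" for n
    by (induction n) (auto intro: csubspace_add_pair[OF B(1)] csubspace_zero_pair[OF B(1)] wB)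
  have sumB: "((\<Sum>n. w n), (\<Sum>n. b n)) \<in> B"
    by (rule closed_sequentially[OF B(2) partial_B tendsto_Pair[OF summable_LIMSEQ[OF s(1)] summable_LIMSEQ[OF s(3)]]])
  have "(\<Sum>n. a (Suc n)) = l *\<^sub>C (\<Sum>n. b n)"
    unfolding ab
    by (rule bounded_linear.suminf[OF bounded_bilinear.bounded_linear_right[OF bounded_bilinear_scaleC] s(3), symmetric])
  then have "(\<Sum>n. a n) = y + l *\<^sub>C (\<Sum>n. b n)"
    using suminf_split_head[OF s(2)] by (simp add: a_def z0 algebra_simps)
  then have "((\<Sum>n. w n), y) \<in> pencil l"
    using sumA by (simp add: pencil_iff[OF sumB])
  moreover have "norm (\<Sum>n. w n) \<le> solve_bound * norm y"
  proof -
    have "norm (\<Sum>n. w n) \<le> (\<Sum>n. norm (w n))" using sw by (rule summable_norm)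
    also have "\<dots> \<le> (\<Sum>n. c * norm y * ?q ^ n)"
      by (intro suminf_le w_norm sw sums_summable[OF geo])
    also have "\<dots> = c * norm y / (1 - ?q)"
      by (rule sums_unique[OF geo, symmetric])
    also have "\<dots> = solve_bound * norm y" by (simp add: solve_bound_def)
    finally show ?thesis .
  qed
  ultimately show ?thesis by blast
qed

text \<open>For \<open>b \<in> \<B> u\<close> one has \<open>(\<mu> - \<lambda>) b \<in> (\<A> - \<lambda>\<B>) u\<close>; subtracting \<open>(\<mu> - \<lambda>) w\<close> with
  \<open>b \<in> (\<A> - \<lambda>\<B>) w\<close> leads into the kernel. The denominator depends on \<open>\<mu>\<close>, because \<open>pencil_improve\<close>
  needs the sharp constant for \<open>\<mu> = 0\<close>.\<close>
lemma kernel_gap: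
  assumes l: "cmod l \<le> \<rho>"
    and m: "cmod m \<le> \<rho>" and u: "u \<in> rel_kernel (pencil m)"
  shows "\<exists>v\<in>rel_kernel (pencil l). norm (u - v) \<le> cmod (m - l) * (solve_bound * (\<sigma> / (1 - \<tau> * cmod m))) * norm u"
proof -
  have u0: "(u, 0) \<in> pencil m" using u by (simp add: rel_kernel_iff)
  obtain b where b: "(u, b) \<in> B" "(1 - \<tau> * cmod m) * norm b \<le> \<sigma> * norm u"
    using pencil_B_bound[OF u0] by auto
  have pos: "0 < 1 - \<tau> * cmod m" using tau_cmod_le[OF m] denominator_pos by simp
  obtain v where v: "v \<in> M_inf" "(v, b) \<in> A"
    using M_inf_step[OF kernel_pencil_sub_M_inf[OF u] b(1)] by blast
  obtain w where w: "(w, b) \<in> pencil l" "norm w \<le> solve_bound * norm b"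
    using pencil_solvable[OF l v] by blast
  have "(u, m *\<^sub>C b) \<in> A" using u0 b by (simp add: pencil_iff)
  then have "(u, (m - l) *\<^sub>C b) \<in> pencil l"
    using b by (simp add: pencil_iff complex_vector.scale_left_diff_distrib)
  from csubspace_diff_pair[OF csubspace_pencil this csubspace_scale_pair[OF csubspace_pencil w(1), of "m - l"]]
  have "u - (m - l) *\<^sub>C w \<in> rel_kernel (pencil l)"
    by (simp add: rel_kernel_iff)
  moreover have "norm w \<le> solve_bound * (\<sigma> / (1 - \<tau> * cmod m) * norm u)"
  proof -
    have "norm b \<le> \<sigma> / (1 - \<tau> * cmod m) * norm u"
      using b(2) pos by (simp add: field_simps)
    then show ?thesis using w(2) solve_bound_nonneg mult_left_mono order_trans by blast
  qed
  then have "norm (u - (u - (m - l) *\<^sub>C w)) \<le> cmod (m - l) * (solve_bound * (\<sigma> / (1 - \<tau> * cmod m) * norm u))"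
    unfolding diff_diff_eq2 add_diff_cancel_left' norm_scaleC by (intro mult_left_mono) auto
  ultimately show ?thesis by (intro bexI) (simp_all add: mult_ac)
qed

text \<open>The improved preimage is \<open>x' = x - v\<close>, where \<open>v\<close> in the kernel of the pencil is close to an element
  \<open>x0\<close> of \<open>N(\<A>)\<close> that is close to \<open>x\<close>. Here \<open>\<parallel>x - x0\<parallel>\<close> is at most \<open>s/(1-t) \<parallel>x\<parallel>\<close>, up to a multiple of
  \<open>\<parallel>y\<parallel>\<close>, and \<open>\<parallel>x0 - v\<parallel>\<close> at most \<open>s/(1-s-t) \<parallel>x0\<parallel>\<close>.\<close>
lemma pencil_improve:
  assumes m: "cmod m \<le> \<rho>" and xy: "(x, y) \<in> pencil m"
  defines "\<theta> \<equiv> 2 * (\<rho> * \<sigma> * c) / (1 - \<rho> * (\<sigma> * c + \<tau>))"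
  shows "\<exists>x'. (x', y) \<in> pencil m \<and> norm x' \<le> \<theta> * norm x + solve_bound * norm y"
proof -
  define s t where "s = \<rho> * \<sigma> * c" and "t = \<rho> * \<tau>"
  have st: "0 \<le> s" "0 \<le> t" "3 * s + t < 1" using rho_small by (simp_all add: s_def t_def)
  define q where "q = s / (1 - s - t)"
  have q: "0 \<le> q" using st by (simp add: q_def)
  have \<theta>: "\<theta> = 2 * s / (1 - s - t)" and solve_bound: "solve_bound = c / (1 - s - t)"
    by (simp_all add: \<theta>_def solve_bound_def s_def t_def algebra_simps)
  obtain b where b: "(x, b) \<in> B" "(1 - \<tau> * cmod m) * norm b \<le> \<sigma> * norm x + \<tau> * norm y"
    using pencil_B_bound[OF xy] by blast
  have "(1 - t) * norm b \<le> (1 - \<tau> * cmod m) * norm b"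
    using tau_cmod_le[OF m] by (intro mult_right_mono) (simp_all add: t_def)
  with b(2) have b_norm: "norm b \<le> (\<sigma> * norm x + \<tau> * norm y) / (1 - t)"
    using st by (simp add: field_simps)
  have "(x, y + m *\<^sub>C b) \<in> A" using xy b by (simp add: pencil_iff)
  from near_kernel[OF this] obtain x0 where x0: "(x0, 0) \<in> A"
    "norm (x - x0) \<le> c * norm (y + m *\<^sub>C b)" by blast
  have "norm (y + m *\<^sub>C b) \<le> norm y + \<rho> * norm b"
    using norm_triangle_ineq[of y "m *\<^sub>C b"] mult_right_mono[OF m norm_ge_zero[of b]]
    by (simp add: norm_scaleC)
  also have "\<dots> \<le> norm y + \<rho> * ((\<sigma> * norm x + \<tau> * norm y) / (1 - t))"
    using b_norm \<rho> by (intro add_mono mult_left_mono) auto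
  finally have "c * norm (y + m *\<^sub>C b) \<le> c * (norm y + \<rho> * ((\<sigma> * norm x + \<tau> * norm y) / (1 - t)))"
    using c by (intro mult_left_mono) auto
  with x0(2) have "norm (x - x0) \<le> c * (norm y + \<rho> * ((\<sigma> * norm x + \<tau> * norm y) / (1 - t)))"
    by (rule order_trans)
  also have "\<dots> = (s * norm x + c * norm y) / (1 - t)"
    using st by (simp add: s_def t_def field_simps)
  finally have d: "norm (x - x0) \<le> (s * norm x + c * norm y) / (1 - t)" .
  have "x0 \<in> rel_kernel (pencil 0)"
    using x0 B_bound[OF x0(1)] by (auto simp: rel_kernel_iff rel_pencil_iff)
  from kernel_gap[OF m _ this] obtain v where v: "v \<in> rel_kernel (pencil m)"
    "norm (x0 - v) \<le> cmod m * (solve_bound * \<sigma>) * norm x0" using \<rho> by auto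
  have "cmod m * (solve_bound * \<sigma>) * norm x0 \<le> \<rho> * (solve_bound * \<sigma>) * norm x0"
    using m solve_bound_nonneg \<sigma> by (intro mult_right_mono) auto
  also have "\<dots> = q * norm x0" by (simp add: solve_bound s_def q_def)
  also have "\<dots> \<le> q * (norm x + norm (x - x0))"
    using q norm_triangle_ineq4[of x "x - x0"] by (intro mult_left_mono) auto
  finally have "norm (x0 - v) \<le> q * (norm x + norm (x - x0))"
    using v(2) by linarith
  moreover have "norm (x - v) \<le> norm (x - x0) + norm (x0 - v)"
    using norm_triangle_ineq[of "x - x0" "x0 - v"] by simp
  ultimately have "norm (x - v) \<le> q * norm x + (1 + q) * norm (x - x0)"
    by (simp add: algebra_simps)
  also have "\<dots> \<le> q * norm x + (1 + q) * ((s * norm x + c * norm y) / (1 - t))"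
    using q by (intro add_left_mono mult_left_mono d) auto
  \<comment> \<open>The factors \<open>1 - t\<close> cancel, which leaves the coefficient \<open>q + s / (1 - s - t) = \<theta>\<close> of \<open>norm x\<close>.\<close>
  also have "1 + q = (1 - t) / (1 - s - t)"
    using st by (simp add: q_def field_simps)
  also have "q * norm x + (1 - t) / (1 - s - t) * ((s * norm x + c * norm y) / (1 - t))
      = q * norm x + (s * norm x + c * norm y) / (1 - s - t)"
    using st by simp
  also have "\<dots> = \<theta> * norm x + solve_bound * norm y"
    by (simp add: q_def \<theta> solve_bound add_divide_distrib)
  finally have "norm (x - v) \<le> \<theta> * norm x + solve_bound * norm y" .
  moreover have "(x - v, y) \<in> pencil m"
    using csubspace_diff_pair[OF csubspace_pencil xy, of v 0] v by (simp add: rel_kernel_iff)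
  ultimately show ?thesis by blast
qed

lemma pencil_bounded_below:
  "\<exists>D\<ge>0. \<forall>m y. cmod m \<le> \<rho> \<longrightarrow> y \<in> Range (pencil m) \<longrightarrow>
    (\<exists>x b. (x, b) \<in> B \<and> (x, y + m *\<^sub>C b) \<in> A \<and> norm x \<le> D * norm y \<and> norm b \<le> D * norm y)"
proof -
  define \<theta> where "\<theta> = 2 * (\<rho> * \<sigma> * c) / (1 - \<rho> * (\<sigma> * c + \<tau>))"
  have \<theta>: "0 \<le> \<theta>" "\<theta> < 1"
    using rho_small denominator_pos by (simp_all add: \<theta>_def field_simps)
  define D where "D = solve_bound / (1 - \<theta>) + 1"
  have D: "0 \<le> D" using \<theta> solve_bound_nonneg by (simp add: D_def)
  define D' where "D' = (\<sigma> * D + \<tau>) / (1 - \<rho> * \<tau>)"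
  have D': "0 \<le> D'" using D \<sigma> \<tau> denominator_pos by (simp add: D'_def)
  have "\<exists>x b. (x, b) \<in> B \<and> (x, y + m *\<^sub>C b) \<in> A \<and> norm x \<le> (D + D') * norm y \<and> norm b \<le> (D + D') * norm y"
    if m: "cmod m \<le> \<rho>" and y: "y \<in> Range (pencil m)" for m y
  proof -
    obtain x0 where "(x0, y) \<in> pencil m" using y by blast
    then obtain x where x: "(x, y) \<in> pencil m" "norm x \<le> D * norm y"
      using bounded_below_if_contraction[OF csubspace_pencil \<theta> solve_bound_nonneg pencil_improve[OF m, folded \<theta>_def]]
      unfolding D_def by blast
    obtain b where b: "(x, b) \<in> B" "(1 - \<tau> * cmod m) * norm b \<le> \<sigma> * norm x + \<tau> * norm y"
      using pencil_B_bound[OF x(1)] by blast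
    have "(1 - \<rho> * \<tau>) * norm b \<le> (1 - \<tau> * cmod m) * norm b"
      using tau_cmod_le[OF m] by (intro mult_right_mono) simp_all
    also have "\<dots> \<le> (\<sigma> * D + \<tau>) * norm y"
      using b(2) mult_left_mono[OF x(2) \<sigma>] by (simp add: algebra_simps)
    finally have "norm b \<le> D' * norm y"
      using denominator_pos by (simp add: D'_def field_simps)
    moreover have "D * norm y \<le> (D + D') * norm y" "D' * norm y \<le> (D + D') * norm y"
      using D D' by (intro mult_right_mono; simp)+
    ultimately show ?thesis using b(1) x by (intro exI[of _ x] exI[of _ b]) (auto simp: pencil_iff)
  qed
  with D D' show ?thesis by (intro exI[of _ "D + D'"]) auto
qed

text \<open>Convergence of \<open>a - \<mu>b\<close> does not entail that of \<open>a\<close> and \<open>b\<close>, so closedness of \<open>\<A>\<close> and \<open>\<B>\<close> does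
  not pass to the pencil directly. Carrying \<open>b\<close> along in the domain yields a closed relation \<open>G\<close> with the same
  range, and the preimages \<open>(x, b)\<close> are still bounded.\<close>
lemma closed_Range_pencil:
  assumes m: "cmod m \<le> \<rho>"
  shows "closed (Range (pencil m))"
proof -
  define G where "G = {((x, b), y) |x b y. (x, b) \<in> B \<and> (x, y + m *\<^sub>C b) \<in> A}"
  have G_iff: "((x, b), y) \<in> G \<longleftrightarrow> (x, b) \<in> B \<and> (x, y + m *\<^sub>C b) \<in> A"
    for x b y
    by (simp add: G_def)
  have "csubspace G"
  proof (rule complex_vector.subspaceI)
    show "0 \<in> G"
      using csubspace_zero_pair[OF A(1)] csubspace_zero_pair[OF B(1)] by (simp add: zero_prod_def G_iff)
  next
    fix u v assume "u \<in> G" "v \<in> G"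
    then obtain x b y x' b' y' where uv: "u = ((x, b), y)" "v = ((x', b'), y')"
      and *: "(x, b) \<in> B" "(x, y + m *\<^sub>C b) \<in> A" "(x', b') \<in> B" "(x', y' + m *\<^sub>C b') \<in> A"
      by (auto simp: G_def)
    have "(x + x', (y + y') + m *\<^sub>C (b + b')) \<in> A"
      using csubspace_add_pair[OF A(1) *(2,4)] by (simp add: scaleC_add_right algebra_simps)
    with csubspace_add_pair[OF B(1) *(1,3)] show "u + v \<in> G" by (simp add: uv G_iff)
  next
    fix k u assume "u \<in> G"
    then obtain x b y where u: "u = ((x, b), y)"
      and *: "(x, b) \<in> B" "(x, y + m *\<^sub>C b) \<in> A"
      by (auto simp: G_def)
    have "(k *\<^sub>C x, k *\<^sub>C y + m *\<^sub>C k *\<^sub>C b) \<in> A"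
      using csubspace_scale_pair[OF A(1) *(2), of k] by (simp add: scaleC_add_right mult.commute)
    with csubspace_scale_pair[OF B(1) *(1), of k] show "k *\<^sub>C u \<in> G"
      by (simp add: u G_iff scaleC_prod_def)
  qed
  moreover have "closed G"
  proof -
    have "G = fst -` B \<inter> (\<lambda>z. (fst (fst z), snd z + m *\<^sub>C snd (fst z))) -` A"
      by (auto simp: G_def)
    moreover have "continuous_on UNIV (\<lambda>z::('a \<times> 'b) \<times> 'b. (fst (fst z), snd z + m *\<^sub>C snd (fst z)))"
      by (intro continuous_intros bounded_linear.continuous_on[OF bounded_bilinear.bounded_linear_right[OF bounded_bilinear_scaleC]])
    ultimately show ?thesis
      using A B by (auto intro!: closed_Int closed_vimage continuous_intros)
  qed
  moreover obtain D where D: "0 \<le> D" and sol: "\<And>y. y \<in> Range (pencil m) \<Longrightarrow>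
    \<exists>x b. (x, b) \<in> B \<and> (x, y + m *\<^sub>C b) \<in> A \<and> norm x \<le> D * norm y \<and> norm b \<le> D * norm y"
    using pencil_bounded_below m by blast
  have Range_G: "Range G = Range (pencil m)"
    by (simp add: Range_iff split_paired_Ex G_iff rel_pencil_iff set_eq_iff)
  have "\<exists>z. (z, y) \<in> G \<and> norm z \<le> 2 * D * norm y" if y: "y \<in> Range G" for y
  proof -
    obtain x b where "(x, b) \<in> B" "(x, y + m *\<^sub>C b) \<in> A" "norm x \<le> D * norm y" "norm b \<le> D * norm y"
      using sol y Range_G by blast
    then show ?thesis
      using norm_Pair_le[of x b] by (intro exI[of _ "(x, b)"]) (auto simp: G_iff)
  qed
  ultimately have "closed (Range G)"
    using D by (intro closed_Range_if_bounded_below[of G "2 * D"]) auto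
  then show ?thesis by (simp add: Range_G)
qed

text \<open>If \<open>y \<in> (\<A> - \<mu>\<B>) x\<close> and \<open>b \<in> \<B> x\<close>, then \<open>y + (\<mu> - \<lambda>) b \<in> (\<A> - \<lambda>\<B>) x\<close>.\<close>
lemma range_gap:
  "\<exists>D\<ge>0. \<forall>l m y. cmod m \<le> \<rho> \<longrightarrow> y \<in> Range (pencil m) \<longrightarrow>
    (\<exists>z\<in>Range (pencil l). norm (y - z) \<le> cmod (m - l) * D * norm y)"
proof -
  obtain D where D: "0 \<le> D" and sol: "\<And>m y. cmod m \<le> \<rho> \<Longrightarrow> y \<in> Range (pencil m) \<Longrightarrow>
    \<exists>x b. (x, b) \<in> B \<and> (x, y + m *\<^sub>C b) \<in> A \<and> norm x \<le> D * norm y \<and> norm b \<le> D * norm y"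
    using pencil_bounded_below by blast
  have "\<exists>z\<in>Range (pencil l). norm (y - z) \<le> cmod (m - l) * D * norm y"
    if m: "cmod m \<le> \<rho>" and y: "y \<in> Range (pencil m)" for l m y
  proof -
    obtain x b where b: "(x, b) \<in> B" "(x, y + m *\<^sub>C b) \<in> A" "norm b \<le> D * norm y"
      using sol[OF m y] by blast
    have "(x, y + (m - l) *\<^sub>C b) \<in> pencil l"
      using b by (simp add: pencil_iff complex_vector.scale_left_diff_distrib)
    then show ?thesis
      using mult_left_mono[OF b(3) norm_ge_zero[of "m - l"]]
      by (intro bexI[of _ "y + (m - l) *\<^sub>C b"]) (auto simp: norm_scaleC mult.assoc)
  qed
  with D show ?thesis by blast
qed

text \<open>A uniform \<open>\<delta>\<close> makes a one-sided implication enough, because \<open>\<lambda>\<close> and \<open>\<mu>\<close> may be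
  exchanged.\<close>
lemma constant_on_disc:
  fixes P :: "complex \<Rightarrow> bool"
  assumes "\<delta> > 0"
    and "\<And>l m. cmod l \<le> \<rho> \<Longrightarrow> cmod m \<le> \<rho> \<Longrightarrow> cmod (m - l) < \<delta> \<Longrightarrow> P m \<Longrightarrow> P l"
    and "cmod l \<le> \<rho>" and "cmod m \<le> \<rho>"
  shows "P l \<longleftrightarrow> P m"
proof (rule connected_local_const[where f = P and A = "cball 0 \<rho>"])
  show "\<forall>a\<in>cball 0 \<rho>. eventually (\<lambda>b. P a = P b) (at a within cball 0 \<rho>)"
  proof
    fix a :: complex assume a: "a \<in> cball 0 \<rho>"
    show "eventually (\<lambda>b. P a = P b) (at a within cball 0 \<rho>)"
      unfolding eventually_at
    proof (intro exI[of _ \<delta>] conjI ballI impI)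
      fix b assume "b \<in> cball 0 \<rho>" "b \<noteq> a \<and> dist b a < \<delta>"
      with a assms(2)[of a b] assms(2)[of b a] show "P a = P b"
        by (auto simp: dist_norm norm_minus_commute)
    qed (rule assms)
  qed
qed (use assms in auto)

lemma nullity_pencil_eq:
  assumes "cmod l \<le> \<rho>" "cmod m \<le> \<rho>"
  shows "nullity (pencil l) = nullity (pencil m)"
proof -
  define L where "L = solve_bound * (\<sigma> / (1 - \<rho> * \<tau>))"
  have L: "0 \<le> L" using solve_bound_nonneg \<sigma> denominator_pos by (simp add: L_def)
  have gap: "\<exists>v\<in>rel_kernel (pencil l). norm (u - v) \<le> cmod (m - l) * L * norm u"
    if lm: "cmod l \<le> \<rho>" "cmod m \<le> \<rho>" and u: "u \<in> rel_kernel (pencil m)"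
      for l m u
  proof -
    have "solve_bound * (\<sigma> / (1 - \<tau> * cmod m)) \<le> L"
      unfolding L_def using solve_bound_nonneg \<sigma> denominator_pos tau_cmod_le[OF lm(2)]
      by (intro mult_left_mono divide_left_mono) auto
    then have "cmod (m - l) * (solve_bound * (\<sigma> / (1 - \<tau> * cmod m))) * norm u \<le> cmod (m - l) * L * norm u"
      by (intro mult_right_mono mult_left_mono) auto
    with kernel_gap[OF lm u] show ?thesis using order_trans by blast
  qed
  have "enat n \<le> nullity (pencil l) \<longleftrightarrow> enat n \<le> nullity (pencil m)" for n
  proof (rule constant_on_disc[where P = "\<lambda>l. enat n \<le> nullity (pencil l)"
    and \<delta> = "1 / (8 * 17 ^ n * (L + 1))"])
    fix l m assume lm: "cmod l \<le> \<rho>" "cmod m \<le> \<rho>"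
      and d: "cmod (m - l) < 1 / (8 * 17 ^ n * (L + 1))"
      and m: "enat n \<le> nullity (pencil m)"
    have "cmod (m - l) * L * 17 ^ n \<le> cmod (m - l) * (L + 1) * 17 ^ n"
      by (intro mult_right_mono mult_left_mono) auto
    also have "\<dots> = cmod (m - l) * (8 * 17 ^ n * (L + 1)) / 8" by simp
    also have "\<dots> \<le> 1 / 8"
      using d L by (subst (asm) pos_less_divide_eq) (auto intro!: divide_right_mono)
    finally have small: "cmod (m - l) * L * 17 ^ n \<le> 1 / 8" .
    have "reldim_ge n (rel_kernel (pencil l)) {0}"
    proof (rule reldim_ge_perturb[where E = "rel_kernel (pencil m)" and F = "{0}"])
      show "reldim_ge n (rel_kernel (pencil m)) {0}"
        using m by (simp add: nullity_def le_cdim_iff_reldim_ge csubspace_rel_kernel csubspace_pencil)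
      show "\<exists>v\<in>rel_kernel (pencil l). norm (u - v) \<le> cmod (m - l) * L * norm u"
        if "u \<in> rel_kernel (pencil m)" for u
        using that by (rule gap[OF lm])
    qed (use L small in \<open>simp_all add: csubspace_rel_kernel csubspace_pencil complex_vector.subspace_0\<close>)
    then show "enat n \<le> nullity (pencil l)"
      by (simp add: nullity_def le_cdim_iff_reldim_ge csubspace_rel_kernel csubspace_pencil)
  qed (use L assms in auto)
  then show ?thesis by (rule enat_eqI)
qed

lemma deficiency_pencil_eq:
  assumes "cmod l \<le> \<rho>" "cmod m \<le> \<rho>"
  shows "deficiency (pencil l) = deficiency (pencil m)"
proof -
  obtain L where L: "0 \<le> L" and gap: "\<And>l m y. cmod m \<le> \<rho> \<Longrightarrow> y \<in> Range (pencil m) \<Longrightarrow>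
    \<exists>z\<in>Range (pencil l). norm (y - z) \<le> cmod (m - l) * L * norm y"
    using range_gap by blast
  have "enat n \<le> deficiency (pencil l) \<longleftrightarrow> enat n \<le> deficiency (pencil m)"
    for n
  proof (rule constant_on_disc[where P = "\<lambda>l. enat n \<le> deficiency (pencil l)"
    and \<delta> = "1 / (8 * 17 ^ n * (L + 1))"])
    fix l m assume lm: "cmod l \<le> \<rho>" "cmod m \<le> \<rho>"
      and d: "cmod (m - l) < 1 / (8 * 17 ^ n * (L + 1))"
      and m: "enat n \<le> deficiency (pencil m)"
    have "cmod (m - l) * L * 17 ^ n \<le> cmod (m - l) * (L + 1) * 17 ^ n"
      by (intro mult_right_mono mult_left_mono) auto
    also have "\<dots> = cmod (m - l) * (8 * 17 ^ n * (L + 1)) / 8" by simp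
    also have "\<dots> \<le> 1 / 8"
      using d L by (subst (asm) pos_less_divide_eq) (auto intro!: divide_right_mono)
    finally have small: "cmod (m - l) * L * 17 ^ n \<le> 1 / 8" .
    have "reldim_ge n UNIV (Range (pencil l))"
    proof (rule reldim_ge_perturb[where E = UNIV and F = "Range (pencil m)"])
      show "reldim_ge n UNIV (Range (pencil m))"
        using m by (simp add: deficiency_def le_quot_dim_iff_reldim_ge csubspace_Range csubspace_pencil)
      show "\<exists>y\<in>Range (pencil m). norm (z - y) \<le> cmod (m - l) * L * norm z"
        if "z \<in> Range (pencil l)" for z
        using gap[OF lm(1) that, of m] by (simp add: norm_minus_commute)
      show "\<exists>g\<in>UNIV. norm (f - g) \<le> cmod (m - l) * L * norm f" for f
        using L by (intro bexI[of _ f]) simp_all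
    qed (use L small in \<open>simp_all add: csubspace_Range csubspace_pencil closed_Range_pencil lm\<close>)
    then show "enat n \<le> deficiency (pencil l)"
      by (simp add: deficiency_def le_quot_dim_iff_reldim_ge csubspace_Range csubspace_pencil)
  qed (use L assms in auto)
  then show ?thesis by (rule enat_eqI)
qed

end

section \<open>The lower bound and the disc of stability\<close>

text \<open>The open mapping theorem gives preimages of norm at most \<open>K\<parallel>y\<parallel>\<close>, and then \<open>1/K\<close> is a candidate
  in the supremum; \<open>K + 1\<close> in place of \<open>K\<close> avoids division by zero.\<close>
lemma lower_bound_pos:
  fixes A :: "('a::complex_banach \<times> 'b::complex_banach) set"
  assumes A: "A \<in> CLR" and R: "closed (Range A)"
  shows "0 < lower_bound A"
proof -
  have lin: "linear_relation A" and sub: "csubspace A" and cl: "closed A"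
    using A by (auto simp: CLR_def linear_relation_def)
  obtain K where K: "0 \<le> K"
    and sol: "\<And>y. y \<in> Range A \<Longrightarrow> \<exists>x. (x, y) \<in> A \<and> norm x \<le> K * norm y"
    using open_mapping_relation[OF sub cl R] by blast
  have "1 / (K + 1) * infdist x (rel_kernel A) \<le> rel_norm A x" if "x \<in> Domain A" for x
  proof -
    from that obtain a where a: "(x, a) \<in> A" by blast
    have "infdist x (rel_kernel A) / (K + 1) \<le> dist a z" if z: "z \<in> A `` {0}" for z
    proof -
      have az: "(x, a - z) \<in> A" using csubspace_diff_pair[OF sub a, of 0 z] z by simp
      then obtain x' where x': "(x', a - z) \<in> A" "norm x' \<le> K * norm (a - z)"
        using sol by blast
      have "x - x' \<in> rel_kernel A"
        using csubspace_diff_pair[OF sub az x'(1)] by (simp add: rel_kernel_iff)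
      then have "infdist x (rel_kernel A) \<le> dist x (x - x')" by (rule infdist_le)
      also have "\<dots> \<le> (K + 1) * dist a z"
        using x'(2) by (simp add: dist_norm algebra_simps add_increasing)
      finally show ?thesis using K by (simp add: field_simps)
    qed
    moreover have "A `` {0} \<noteq> {}" using csubspace_zero_pair[OF sub] by blast
    ultimately have "infdist x (rel_kernel A) / (K + 1) \<le> infdist a (A `` {0})"
      by (auto simp: infdist_notempty intro!: cINF_greatest)
    then show ?thesis by (simp add: rel_norm_eq_infdist[OF lin a])
  qed
  with K have "ereal (1 / (K + 1)) \<le> lower_bound A"
    unfolding lower_bound_def by (intro Sup_upper) auto
  moreover have "0 < ereal (1 / (K + 1))" using K by simp
  ultimately show ?thesis by (rule less_le_trans[rotated])
qed

text \<open>Solving \<open>r < g/(3s + tg)\<close> for \<open>g\<close> brings the three cases in the definition of the bound to a common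
  form, a strict lower estimate for \<open>g\<close>, which also holds for some element of a set with supremum
  \<open>g\<close>.\<close>
lemma less_pencil_bound:
  assumes s: "0 \<le> s" and t: "0 \<le> t" and r: "0 \<le> r" and g: "0 < g"
    and less: "ereal r < pencil_bound s t g"
  shows "t * r < 1" and "ereal (3 * s * r / (1 - t * r)) < g"
proof -
  have "t * r < 1 \<and> ereal (3 * s * r / (1 - t * r)) < g"
  proof (cases g)
    case (real \<gamma>)
    then have \<gamma>: "0 < \<gamma>" using g by simp
    show ?thesis
    proof (cases "3 * s + t * \<gamma> = 0")
      case True
      moreover have "0 \<le> t * \<gamma>" using t \<gamma> by simp
      ultimately have "s = 0" "t * \<gamma> = 0" using s by linarith+
      with \<gamma> real show ?thesis by simp
    next
      case False
      moreover have "0 \<le> t * \<gamma>" using t \<gamma> by simp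
      ultimately have D: "0 < 3 * s + t * \<gamma>" using s by linarith
      have "r < \<gamma> / (3 * s + t * \<gamma>)"
        using less False real by (simp add: pencil_bound_def)
      then have *: "3 * s * r + (t * r) * \<gamma> < \<gamma>" using D by (simp add: field_simps)
      moreover have "0 \<le> 3 * s * r" using s r by simp
      ultimately have "(t * r) * \<gamma> < 1 * \<gamma>" by linarith
      then have tr: "t * r < 1" using \<gamma> by (simp only: mult_less_cancel_right_pos)
      with * have "3 * s * r / (1 - t * r) < \<gamma>" by (simp add: field_simps)
      with tr real show ?thesis by simp
    qed
  next
    case PInf
    then show ?thesis
      using less t by (cases "t = 0") (auto simp: pencil_bound_def field_simps)
  qed (use g in auto)
  then show "t * r < 1" and "ereal (3 * s * r / (1 - t * r)) < g" by blast+
qed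

text \<open>The inequality for \<open>r\<close> is strict, so it survives a small enlargement of \<open>s\<close> and \<open>1/g\<close>.\<close>
lemma exists_slack:
  fixes s t r g :: real
  assumes "0 < g" and "r * (3 * s + t * g) < g"
  shows "\<exists>d>0. r * (3 * (s + d) * (1 / g + d) + t) < 1"
proof -
  have "((\<lambda>d. r * (3 * (s + d) * (1 / g + d) + t)) \<longlongrightarrow> r * (3 * (s + 0) * (1 / g + 0) + t)) (at_right 0)"
    by (intro tendsto_intros)
  moreover have "r * (3 * (s + 0) * (1 / g + 0) + t) < 1"
    using assms by (simp add: field_simps)
  ultimately have "eventually (\<lambda>d. r * (3 * (s + d) * (1 / g + d) + t) < 1) (at_right 0)"
    by (rule order_tendstoD)
  then have "eventually (\<lambda>d. 0 < d \<and> r * (3 * (s + d) * (1 / g + d) + t) < 1) (at_right 0)"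
    using eventually_at_right_less[of 0] by eventually_elim simp
  then show ?thesis by (rule eventually_happens'[rotated]) simp
qed

theorem theorem7p4:
  fixes A B :: "('a::complex_banach \<times> 'b::complex_banach) set"
    and \<sigma> \<tau> :: real
  assumes "A \<in> CLR" and "B \<in> CLR"
    and "closed (Range A)"
    and "Domain A \<subseteq> Domain B"
    and "B `` {0} \<subseteq> A `` {0}"
    and "0 \<le> \<sigma>" and "0 \<le> \<tau>"
    and "\<forall>x\<in>Domain A. rel_norm B x \<le> \<sigma> * norm x + \<tau> * rel_norm A x"
    and "nu A B = \<infinity>"
  shows "(\<lambda>l. nullity (rel_pencil A l B)) constant_on
           {l. ereal (cmod l) < pencil_bound \<sigma> \<tau> (lower_bound A)}
         \<and> (\<lambda>l. deficiency (rel_pencil A l B)) constant_on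
           {l. ereal (cmod l) < pencil_bound \<sigma> \<tau> (lower_bound A)}"
proof -
  have linA: "linear_relation A" and A: "csubspace A" "closed A"
    and linB: "linear_relation B" and B: "csubspace B" "closed B"
    using assms by (auto simp: CLR_def linear_relation_def)
  have "nullity (rel_pencil A l B) = nullity (rel_pencil A 0 B)
      \<and> deficiency (rel_pencil A l B) = deficiency (rel_pencil A 0 B)"
    if l: "ereal (cmod l) < pencil_bound \<sigma> \<tau> (lower_bound A)" for l
  proof -
    \<comment> \<open>The condition on \<open>l\<close> is \<open>g > r0\<close> for a candidate \<open>g\<close> in the supremum that defines \<open>\<gamma>(\<A>)\<close>.\<close>
    define r0 where "r0 = 3 * \<sigma> * cmod l / (1 - \<tau> * cmod l)"
    have \<tau>l: "\<tau> * cmod l < 1" and r0: "ereal r0 < lower_bound A"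
      using less_pencil_bound[OF \<open>0 \<le> \<sigma>\<close> \<open>0 \<le> \<tau>\<close> norm_ge_zero lower_bound_pos l] assms
      by (auto simp: r0_def)
    then obtain g where g: "r0 < g"
      and lower: "\<And>x. x \<in> Domain A \<Longrightarrow> g * infdist x (rel_kernel A) \<le> rel_norm A x"
      unfolding lower_bound_def less_Sup_iff by auto
    have "0 \<le> r0" using \<tau>l \<open>0 \<le> \<sigma>\<close> by (simp add: r0_def)
    then have g_pos: "0 < g" using g by simp
    have "cmod l * (3 * \<sigma> + \<tau> * g) < g"
      using g \<tau>l by (simp add: r0_def field_simps)
    from exists_slack[OF g_pos this] obtain d
      where d: "0 < d" "cmod l * (3 * (\<sigma> + d) * (1 / g + d) + \<tau>) < 1" by blast
    interpret regular_pencil A B "\<sigma> + d" \<tau> "1 / g + d" "cmod l"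
    proof
      show "0 < 1 / g + d" using g_pos d by (simp add: add_pos_pos)
      show "\<exists>x0. (x0, 0) \<in> A \<and> norm (x - x0) \<le> (1 / g + d) * norm a" if xa: "(x, a) \<in> A"
        for x a
      proof (cases "a = 0")
        case True
        with xa d g_pos show ?thesis by (intro exI[of _ x]) auto
      next
        case False
        have zero: "0 \<in> A `` {0}" "0 \<in> rel_kernel A"
          using csubspace_zero_pair[OF A(1)] by (simp_all add: rel_kernel_iff)
        have "g * infdist x (rel_kernel A) \<le> infdist a (A `` {0})"
          using lower[of x] xa by (auto simp: rel_norm_eq_infdist[OF linA xa])
        also have "\<dots> \<le> norm a" using infdist_le[OF zero(1), of a] by simp
        finally have "infdist x (rel_kernel A) \<le> 1 / g * norm a"
          using g_pos by (simp add: field_simps)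
        also have "\<dots> < (1 / g + d) * norm a"
          using False d by (intro mult_strict_right_mono) auto
        finally obtain x0 where "x0 \<in> rel_kernel A" "dist x x0 < (1 / g + d) * norm a"
          using infdist_near_point[of "rel_kernel A" x] zero by blast
        then show ?thesis by (intro exI[of _ x0]) (simp add: rel_kernel_iff dist_norm)
      qed
      show "\<exists>b. (x, b) \<in> B \<and> (\<forall>a'. (x, a') \<in> A \<longrightarrow> norm b \<le> (\<sigma> + d) * norm x + \<tau> * norm a')"
        if xa: "(x, a) \<in> A" for x a
      proof (cases "x = 0")
        case True
        then show ?thesis
          using csubspace_zero_pair[OF B(1)] \<open>0 \<le> \<tau>\<close> by (intro exI[of _ 0]) simp
      next
        case False
        obtain b0 where b0: "(x, b0) \<in> B" using assms(4) xa by blast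
        have "infdist b0 (B `` {0}) \<le> \<sigma> * norm x + \<tau> * rel_norm A x"
          using assms(8) xa by (auto simp flip: rel_norm_eq_infdist[OF linB b0])
        also have "\<dots> < (\<sigma> + d) * norm x + \<tau> * rel_norm A x"
          using False d by (simp add: algebra_simps)
        finally obtain z where z: "(0, z) \<in> B" "dist b0 z < (\<sigma> + d) * norm x + \<tau> * rel_norm A x"
          using infdist_near_point[of "B `` {0}" b0] csubspace_zero_pair[OF B(1)] by blast
        have "norm (b0 - z) \<le> (\<sigma> + d) * norm x + \<tau> * norm a'" if xa': "(x, a') \<in> A"
          for a'
        proof -
          have "rel_norm A x \<le> norm a'"
            using infdist_le[of 0 "A `` {0}" a'] csubspace_zero_pair[OF A(1)]
            by (simp add: rel_norm_eq_infdist[OF linA xa'])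
          then have "\<tau> * rel_norm A x \<le> \<tau> * norm a'"
            using \<open>0 \<le> \<tau>\<close> by (rule mult_left_mono)
          with z show ?thesis by (simp add: dist_norm)
        qed
        moreover have "(x, b0 - z) \<in> B" using csubspace_diff_pair[OF B(1) b0 z(1)] by simp
        ultimately show ?thesis by blast
      qed
      show "x \<in> M_seq A B n" if "(x, 0) \<in> A" for x n
      proof (cases "n = 0")
        case False
        then have "n \<ge> 1" by simp
        moreover have "\<not> (\<exists>n\<ge>1. \<not> rel_kernel A \<subseteq> M_seq A B n)"
          using \<open>nu A B = \<infinity>\<close> unfolding nu_def by (auto split: if_splits)
        ultimately have "rel_kernel A \<subseteq> M_seq A B n" by blast
        with that show ?thesis by (auto simp: rel_kernel_iff)
      qed simp
    qed (use A B assms d in auto)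
    show ?thesis
      using nullity_pencil_eq[of l 0] deficiency_pencil_eq[of l 0] by simp
  qed
  then show ?thesis by (auto simp: constant_on_def)
qed

end
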